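(* Let $(M,\varphi,\xi,\eta,g)$ be a 3-dimensional Sasaki-like almost contact B-metric manifold with associated metric $\widetilde g$, and let $(C(t),\overline{\mathbf F})$ be a slant null curve with respect to $g$ in $M$, with $a=\eta(\dot C)$ constant, for which $b=g(\dot C,\varphi\dot C)=0$. Then $C$ with respect to $\widetilde g$ is a spacelike slant curve in $M$ such that: (i) $C$ is a Frenet curve of osculating order 3, and the vector fields $E_1,E_2,E_3$, orthonormal with respect to $\widetilde g$, are $$E_1(\widetilde s)=C'(\widetilde s)=\frac{\dot C}{|a|},\quad \widetilde g(E_1,E_1)=1,$$ where $\widetilde s$ is the arc length parameter of $C(t)$ with respect to $\widetilde g$, $$E_2(\widetilde s)=-\frac1a\varphi\dot C+\xi,\quad \widetilde g(E_2,E_2)=1,$$ $$E_3(\widetilde s)=\frac{1}{|a|}(\varphi\dot C-\dot C),\quad \widetilde g(E_3,E_3)=-1.$$ (ii) $C(\widetilde s)$ is a proper helix whose curvature $\widetilde k$ and torsion $\widetilde\tau$ are $\widetilde k(\widetilde s)=\widetilde\tau(\widetilde s)=1$.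
   Context: A 3-dimensional almost contact B-metric manifold $(M,\varphi,\xi,\eta,g)$ is a smooth 3-manifold with an endomorphism $\varphi$ of $TM$, a vector field $\xi$, a 1-form $\eta$ and a pseudo-Riemannian metric $g$ (necessarily of signature $(+,+,-)$) such that $\varphi^2X=-X+\eta(X)\xi$, $\eta(\xi)=1$, $g(\varphi X,\varphi Y)=-g(X,Y)+\eta(X)\eta(Y)$. Consequences: $\eta\circ\varphi=0$, $\varphi\xi=0$, $\eta(X)=g(X,\xi)$. With $\nabla$ the Levi-Civita connection of $g$, it is Sasaki-like if $(\nabla_X\varphi)Y=-g(X,Y)\xi-\eta(Y)X+2\eta(X)\eta(Y)\xi$ (then $\nabla_X\xi=-\varphi X$). The associated metric is $\widetilde g(X,Y)=g(X,\varphi Y)+\eta(X)\eta(Y)$, again of signature $(+,+,-)$, with Levi-Civita connection $\widetilde\nabla$. On a 3-dimensional Sasaki-like manifold it is known that $\widetilde\nabla_XY-\nabla_XY=-\{g(X,\varphi Y)-g(\varphi X,\varphi Y)\}\xi$. A smooth curve $C:I\to M$ ($I$ an interval) is null with respect to $g$ if $g(\dot C,\dot C)=0$, $\dot C\neq 0$ on $I$; slant (w.r.t. $g$) if $\eta(\dot C)=a$ is constant. For a slant null curve with $b=g(\dot C,\varphi\dot C)=0$ one has $a\neq0$. The notation $(C(t),\overline{\mathbf F})$ means that $C$ is taken with its original parameter $t$ and the null Frenet frame $\overline{\mathbf F}=\{\dot C,\overline N,\overline W\}$ with $\overline W$ a $g$-unit field proportional to $\nabla_{\dot C}\dot C$ (for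 $b=0$: $\overline W=\pm\frac1a\varphi\dot C$) and $\overline N$ determined by $g(\dot C,\overline N)=1$, $g(\overline N,\overline N)=g(\overline N,\overline W)=0$. With respect to $\widetilde g$: a unit speed curve $\gamma(s)$ with $\widetilde g(\gamma',\gamma')=\epsilon_1=\pm1$ is spacelike if $\epsilon_1=1$, timelike if $\epsilon_1=-1$; it is slant if $\widetilde g(\gamma',\xi)=\eta(\gamma')$ is constant. It is a Frenet curve of osculating order 3 if there exist orthonormal vector fields $E_1=\gamma',E_2,E_3$ along $\gamma$ with $\widetilde g(E_i,E_i)=\epsilon_i=\pm1$, $\epsilon_3=-\epsilon_1\epsilon_2$, and positive functions $\widetilde k$ (curvature) and $\widetilde\tau$ (torsion) such that $\widetilde\nabla_{\gamma'}E_1=\epsilon_2\widetilde kE_2$, $\widetilde\nabla_{\gamma'}E_2=-\epsilon_1\widetilde kE_1+\epsilon_3\widetilde\tau E_3$, $\widetilde\nabla_{\gamma'}E_3=-\epsilon_2\widetilde\tau E_2$. A Frenet curve is a helix if its curvature and torsion are constant, a pseudo-circle if its curvature is constant and torsion zero, and a proper helix if it is a helix which is not a (pseudo-)circle. *)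

theory Defs
  imports "HOL-Analysis.Analysis"
begin

section \<open>Smooth maps\<close>

text \<open>Derivatives are taken within \<open>S\<close>, so that the same notion serves for open subsets of
  \<open>real^3\<close> and for (relatively open subsets of) real intervals that may contain their end points.\<close>

primrec Ck_on :: "nat \<Rightarrow> 'a::real_normed_vector set \<Rightarrow> ('a \<Rightarrow> 'b::real_normed_vector) \<Rightarrow> bool" where
  "Ck_on 0 S f \<longleftrightarrow> continuous_on S f"
| "Ck_on (Suc k) S f \<longleftrightarrow> (\<forall>x\<in>S. f differentiable (at x within S)) \<and>
     (\<forall>v. Ck_on k S (\<lambda>x. frechet_derivative f (at x within S) v))"

definition smooth_on :: "'a::real_normed_vector set \<Rightarrow> ('a \<Rightarrow> 'b::real_normed_vector) \<Rightarrow> bool" where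
  "smooth_on S f \<longleftrightarrow> (\<forall>k. Ck_on k S f)"


section \<open>Smooth 3-manifolds\<close>

text \<open>A chart is a domain together with a coordinate map. The manifold is the whole type \<open>'m\<close>;
  its smooth structure is given by an atlas.\<close>

type_synonym 'm chart = "'m set \<times> ('m \<Rightarrow> real^3)"

abbreviation dom_chart :: "'m chart \<Rightarrow> 'm set" where "dom_chart c \<equiv> fst c"
abbreviation coords :: "'m chart \<Rightarrow> 'm \<Rightarrow> real^3" where "coords c \<equiv> snd c"

definition img_chart :: "'m chart \<Rightarrow> (real^3) set" where
  "img_chart c = coords c ` dom_chart c"

definition param :: "'m chart \<Rightarrow> real^3 \<Rightarrow> 'm" where
  "param c = inv_into (dom_chart c) (coords c)"

definition is_chart :: "'m::topological_space chart \<Rightarrow> bool" where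
  "is_chart c \<longleftrightarrow> open (dom_chart c) \<and> open (img_chart c) \<and>
     homeomorphism (dom_chart c) (img_chart c) (coords c) (param c)"

definition smooth_atlas :: "'m::{t2_space,second_countable_topology} chart set \<Rightarrow> bool" where
  "smooth_atlas A \<longleftrightarrow> (\<Union>c\<in>A. dom_chart c) = UNIV \<and> (\<forall>c\<in>A. is_chart c) \<and>
     (\<forall>c\<in>A. \<forall>c'\<in>A. smooth_on (coords c ` (dom_chart c \<inter> dom_chart c')) (coords c' \<circ> param c))"

text \<open>Functions of a point of the chart domain are differentiated in the coordinates of the chart.\<close>

definition smooth_in_chart :: "'m chart \<Rightarrow> ('m \<Rightarrow> 'b::real_normed_vector) \<Rightarrow> bool" where
  "smooth_in_chart c f \<longleftrightarrow> smooth_on (img_chart c) (\<lambda>x. f (param c x))"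

definition chart_deriv :: "'m chart \<Rightarrow> ('m \<Rightarrow> 'b::real_normed_vector) \<Rightarrow> 'm \<Rightarrow> real^3 \<Rightarrow> 'b" where
  "chart_deriv c f p u = frechet_derivative (\<lambda>x. f (param c x)) (at (coords c p)) u"

text \<open>The Jacobian at \<open>p\<close> of the change of coordinates from \<open>c\<close> to \<open>c'\<close>.\<close>

definition jac :: "'m chart \<Rightarrow> 'm chart \<Rightarrow> 'm \<Rightarrow> real^3 \<Rightarrow> real^3" where
  "jac c c' p = chart_deriv c (coords c') p"


section \<open>Tensor fields\<close>

text \<open>A tensor field is a family of components, one for each chart, with the tensorial behaviour
  under changes of charts. The components at a point \<open>p\<close> of a chart \<open>c\<close> are written as
  (multi)linear maps on \<open>real^3\<close>, the tangent space at \<open>p\<close> expressed in the coordinates of \<open>c\<close>.\<close>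

type_synonym 'm vec_field = "'m chart \<Rightarrow> 'm \<Rightarrow> real^3"
type_synonym 'm form_field = "'m chart \<Rightarrow> 'm \<Rightarrow> real^3 \<Rightarrow> real"
type_synonym 'm endo_field = "'m chart \<Rightarrow> 'm \<Rightarrow> real^3 \<Rightarrow> real^3"
type_synonym 'm bilin_field = "'m chart \<Rightarrow> 'm \<Rightarrow> real^3 \<Rightarrow> real^3 \<Rightarrow> real"

definition vector_field :: "'m chart set \<Rightarrow> 'm vec_field \<Rightarrow> bool" where
  "vector_field A X \<longleftrightarrow> (\<forall>c\<in>A. smooth_in_chart c (X c)) \<and>
     (\<forall>c\<in>A. \<forall>c'\<in>A. \<forall>p\<in>dom_chart c \<inter> dom_chart c'. X c' p = jac c c' p (X c p))"

definition one_form :: "'m chart set \<Rightarrow> 'm form_field \<Rightarrow> bool" where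
  "one_form A \<alpha> \<longleftrightarrow>
     (\<forall>c\<in>A. (\<forall>p\<in>dom_chart c. linear (\<alpha> c p)) \<and> (\<forall>v. smooth_in_chart c (\<lambda>p. \<alpha> c p v))) \<and>
     (\<forall>c\<in>A. \<forall>c'\<in>A. \<forall>p\<in>dom_chart c \<inter> dom_chart c'. \<forall>v. \<alpha> c' p (jac c c' p v) = \<alpha> c p v)"

definition endomorphism_field :: "'m chart set \<Rightarrow> 'm endo_field \<Rightarrow> bool" where
  "endomorphism_field A \<phi> \<longleftrightarrow>
     (\<forall>c\<in>A. (\<forall>p\<in>dom_chart c. linear (\<phi> c p)) \<and> (\<forall>v. smooth_in_chart c (\<lambda>p. \<phi> c p v))) \<and>
     (\<forall>c\<in>A. \<forall>c'\<in>A. \<forall>p\<in>dom_chart c \<inter> dom_chart c'. \<forall>v.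
        \<phi> c' p (jac c c' p v) = jac c c' p (\<phi> c p v))"

definition pseudo_riemannian_metric :: "'m chart set \<Rightarrow> 'm bilin_field \<Rightarrow> bool" where
  "pseudo_riemannian_metric A g \<longleftrightarrow>
     (\<forall>c\<in>A. (\<forall>p\<in>dom_chart c. bilinear (g c p) \<and> (\<forall>v w. g c p v w = g c p w v) \<and>
                (\<forall>v. (\<forall>w. g c p v w = 0) \<longrightarrow> v = 0)) \<and>
            (\<forall>v w. smooth_in_chart c (\<lambda>p. g c p v w))) \<and>
     (\<forall>c\<in>A. \<forall>c'\<in>A. \<forall>p\<in>dom_chart c \<inter> dom_chart c'. \<forall>v w.
        g c' p (jac c c' p v) (jac c c' p w) = g c p v w)"


section \<open>The Levi-Civita connection\<close>

text \<open>An affine connection is given by its Christoffel symbols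
  \<open>\<Gamma> c p (\<partial>\<^sub>i, \<partial>\<^sub>j) = \<Gamma>\<^sup>k\<^sub>i\<^sub>j(p) \<partial>\<^sub>k\<close>, extended bilinearly. The term with the second derivative
  of the change of coordinates is what makes \<open>cov_deriv\<close> below independent of the chart.\<close>

type_synonym 'm conn = "'m chart \<Rightarrow> 'm \<Rightarrow> real^3 \<Rightarrow> real^3 \<Rightarrow> real^3"

definition affine_connection :: "'m chart set \<Rightarrow> 'm conn \<Rightarrow> bool" where
  "affine_connection A \<Gamma> \<longleftrightarrow>
     (\<forall>c\<in>A. (\<forall>p\<in>dom_chart c. bilinear (\<Gamma> c p)) \<and> (\<forall>u v. smooth_in_chart c (\<lambda>p. \<Gamma> c p u v))) \<and>
     (\<forall>c\<in>A. \<forall>c'\<in>A. \<forall>p\<in>dom_chart c \<inter> dom_chart c'. \<forall>u v.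
        \<Gamma> c' p (jac c c' p u) (jac c c' p v) =
          jac c c' p (\<Gamma> c p u v) - chart_deriv c (\<lambda>q. jac c c' q v) p u)"

text \<open>\<open>cov_deriv \<Gamma> c Y p u\<close> is \<open>\<nabla>\<^sub>u Y\<close> at \<open>p\<close>, for a vector field \<open>Y\<close> on the chart domain.\<close>

definition cov_deriv :: "'m conn \<Rightarrow> 'm chart \<Rightarrow> ('m \<Rightarrow> real^3) \<Rightarrow> 'm \<Rightarrow> real^3 \<Rightarrow> real^3" where
  "cov_deriv \<Gamma> c Y p u = chart_deriv c Y p u + \<Gamma> c p u (Y p)"

definition lie_bracket :: "'m chart \<Rightarrow> ('m \<Rightarrow> real^3) \<Rightarrow> ('m \<Rightarrow> real^3) \<Rightarrow> 'm \<Rightarrow> real^3" where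
  "lie_bracket c X Y p = chart_deriv c Y p (X p) - chart_deriv c X p (Y p)"

definition levi_civita :: "'m chart set \<Rightarrow> 'm bilin_field \<Rightarrow> 'm conn \<Rightarrow> bool" where
  "levi_civita A g \<Gamma> \<longleftrightarrow> affine_connection A \<Gamma> \<and>
     (\<forall>c\<in>A. \<forall>X Y. smooth_in_chart c X \<and> smooth_in_chart c Y \<longrightarrow>
        (\<forall>p\<in>dom_chart c.
           cov_deriv \<Gamma> c Y p (X p) - cov_deriv \<Gamma> c X p (Y p) = lie_bracket c X Y p)) \<and>
     (\<forall>c\<in>A. \<forall>X Y Z. smooth_in_chart c X \<and> smooth_in_chart c Y \<and> smooth_in_chart c Z \<longrightarrow>
        (\<forall>p\<in>dom_chart c.
           chart_deriv c (\<lambda>q. g c q (Y q) (Z q)) p (X p) =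
             g c p (cov_deriv \<Gamma> c Y p (X p)) (Z p) + g c p (Y p) (cov_deriv \<Gamma> c Z p (X p))))"


section \<open>Sasaki-like almost contact B-metric manifolds\<close>

definition almost_contact_B_metric ::
  "'m::{t2_space,second_countable_topology} chart set \<Rightarrow> 'm endo_field \<Rightarrow> 'm vec_field \<Rightarrow>
   'm form_field \<Rightarrow> 'm bilin_field \<Rightarrow> bool" where
  "almost_contact_B_metric A \<phi> \<xi> \<eta> g \<longleftrightarrow> smooth_atlas A \<and> endomorphism_field A \<phi> \<and>
     vector_field A \<xi> \<and> one_form A \<eta> \<and> pseudo_riemannian_metric A g \<and>
     (\<forall>c\<in>A. \<forall>p\<in>dom_chart c.
        (\<forall>u. \<phi> c p (\<phi> c p u) = - u + \<eta> c p u *\<^sub>R \<xi> c p) \<and>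
        \<eta> c p (\<xi> c p) = 1 \<and>
        (\<forall>u v. g c p (\<phi> c p u) (\<phi> c p v) = - g c p u v + \<eta> c p u * \<eta> c p v))"

text \<open>\<open>\<Gamma>\<close> is the Levi-Civita connection of \<open>g\<close>; the left hand side of the equation is
  \<open>(\<nabla>\<^sub>X \<phi>) Y = \<nabla>\<^sub>X (\<phi> Y) - \<phi> (\<nabla>\<^sub>X Y)\<close>.\<close>

definition sasaki_like ::
  "'m::{t2_space,second_countable_topology} chart set \<Rightarrow> 'm endo_field \<Rightarrow> 'm vec_field \<Rightarrow>
   'm form_field \<Rightarrow> 'm bilin_field \<Rightarrow> 'm conn \<Rightarrow> bool" where
  "sasaki_like A \<phi> \<xi> \<eta> g \<Gamma> \<longleftrightarrow> almost_contact_B_metric A \<phi> \<xi> \<eta> g \<and> levi_civita A g \<Gamma> \<and>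
     (\<forall>c\<in>A. \<forall>X Y. smooth_in_chart c X \<and> smooth_in_chart c Y \<longrightarrow>
        (\<forall>p\<in>dom_chart c.
           cov_deriv \<Gamma> c (\<lambda>q. \<phi> c q (Y q)) p (X p) - \<phi> c p (cov_deriv \<Gamma> c Y p (X p)) =
             - g c p (X p) (Y p) *\<^sub>R \<xi> c p - \<eta> c p (Y p) *\<^sub>R X p
             + (2 * \<eta> c p (X p) * \<eta> c p (Y p)) *\<^sub>R \<xi> c p))"

definition associated_metric ::
  "'m endo_field \<Rightarrow> 'm form_field \<Rightarrow> 'm bilin_field \<Rightarrow> 'm bilin_field" where
  "associated_metric \<phi> \<eta> g c p u v = g c p u (\<phi> c p v) + \<eta> c p u * \<eta> c p v"


section \<open>Curves\<close>

definition smooth_curve ::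
  "'m::topological_space chart set \<Rightarrow> real set \<Rightarrow> (real \<Rightarrow> 'm) \<Rightarrow> bool" where
  "smooth_curve A I C \<longleftrightarrow> is_interval I \<and> (\<exists>x\<in>I. \<exists>y\<in>I. x < y) \<and> continuous_on I C \<and>
     (\<forall>c\<in>A. smooth_on {t\<in>I. C t \<in> dom_chart c} (coords c \<circ> C))"

text \<open>Vector fields along a curve are given by their components in the charts, as functions of
  the parameter.\<close>

type_synonym 'm field_along = "'m chart \<Rightarrow> real \<Rightarrow> real^3"

definition smooth_field_along ::
  "'m chart set \<Rightarrow> real set \<Rightarrow> (real \<Rightarrow> 'm) \<Rightarrow> 'm field_along \<Rightarrow> bool" where
  "smooth_field_along A I C V \<longleftrightarrow>
     (\<forall>c\<in>A. smooth_on {t\<in>I. C t \<in> dom_chart c} (V c)) \<and>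
     (\<forall>c\<in>A. \<forall>c'\<in>A. \<forall>t\<in>I. C t \<in> dom_chart c \<inter> dom_chart c' \<longrightarrow>
        V c' t = jac c c' (C t) (V c t))"

definition velocity :: "real set \<Rightarrow> (real \<Rightarrow> 'm) \<Rightarrow> 'm field_along" where
  "velocity I C c t = vector_derivative (coords c \<circ> C) (at t within I)"

definition cov_deriv_along ::
  "'m conn \<Rightarrow> real set \<Rightarrow> (real \<Rightarrow> 'm) \<Rightarrow> 'm field_along \<Rightarrow> 'm field_along" where
  "cov_deriv_along \<Gamma> I C V c t =
     vector_derivative (V c) (at t within I) + \<Gamma> c (C t) (velocity I C c t) (V c t)"

definition null_curve ::
  "'m::topological_space chart set \<Rightarrow> 'm bilin_field \<Rightarrow> real set \<Rightarrow> (real \<Rightarrow> 'm) \<Rightarrow> bool" where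
  "null_curve A g I C \<longleftrightarrow> smooth_curve A I C \<and>
     (\<forall>t\<in>I. \<forall>c\<in>A. C t \<in> dom_chart c \<longrightarrow>
        g c (C t) (velocity I C c t) (velocity I C c t) = 0 \<and> velocity I C c t \<noteq> 0)"

definition slant ::
  "'m chart set \<Rightarrow> 'm form_field \<Rightarrow> real set \<Rightarrow> (real \<Rightarrow> 'm) \<Rightarrow> real \<Rightarrow> bool" where
  "slant A \<eta> I C a \<longleftrightarrow>
     (\<forall>t\<in>I. \<forall>c\<in>A. C t \<in> dom_chart c \<longrightarrow> \<eta> c (C t) (velocity I C c t) = a)"

text \<open>The orthogonality \<open>g(C', W) = 0\<close> is not listed: it follows from \<open>g(C', C') = 0\<close>, since \<open>W\<close> is a
  multiple of \<open>\<nabla> C'/dt\<close>.\<close>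

definition null_frenet_frame ::
  "'m::topological_space chart set \<Rightarrow> 'm bilin_field \<Rightarrow> 'm conn \<Rightarrow> real set \<Rightarrow> (real \<Rightarrow> 'm) \<Rightarrow>
   'm field_along \<Rightarrow> 'm field_along \<Rightarrow> bool" where
  "null_frenet_frame A g \<Gamma> I C N W \<longleftrightarrow>
     smooth_field_along A I C N \<and> smooth_field_along A I C W \<and>
     (\<forall>t\<in>I. \<exists>r. \<forall>c\<in>A. C t \<in> dom_chart c \<longrightarrow>
        W c t = r *\<^sub>R cov_deriv_along \<Gamma> I C (velocity I C) c t) \<and>
     (\<forall>t\<in>I. \<forall>c\<in>A. C t \<in> dom_chart c \<longrightarrow>
        g c (C t) (W c t) (W c t) = 1 \<and>
        g c (C t) (velocity I C c t) (N c t) = 1 \<and>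
        g c (C t) (N c t) (N c t) = 0 \<and>
        g c (C t) (N c t) (W c t) = 0)"

text \<open>The speed \<open>sqrt \<bar>h(C', C')\<bar>\<close> does not depend on the chart, so any chart around the point
  may be used to compute it.\<close>

definition speed ::
  "'m chart set \<Rightarrow> 'm bilin_field \<Rightarrow> real set \<Rightarrow> (real \<Rightarrow> 'm) \<Rightarrow> real \<Rightarrow> real" where
  "speed A h I C t =
     (let c = (SOME c. c \<in> A \<and> C t \<in> dom_chart c)
      in sqrt \<bar>h c (C t) (velocity I C c t) (velocity I C c t)\<bar>)"

text \<open>The difference of the two integrals is the oriented integral from \<open>t0\<close> to \<open>t\<close>:
  at least one of them is taken over an empty or one-point interval.\<close>

definition arc_length_parameter ::
  "'m chart set \<Rightarrow> 'm bilin_field \<Rightarrow> real set \<Rightarrow> (real \<Rightarrow> 'm) \<Rightarrow> (real \<Rightarrow> real) \<Rightarrow> bool" where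
  "arc_length_parameter A h I C s \<longleftrightarrow>
     (\<exists>t0\<in>I. \<forall>t\<in>I. s t = integral {t0..t} (speed A h I C) - integral {t..t0} (speed A h I C))"


section \<open>Frenet curves\<close>

definition unit_speed_curve ::
  "'m::topological_space chart set \<Rightarrow> 'm bilin_field \<Rightarrow> real set \<Rightarrow> (real \<Rightarrow> 'm) \<Rightarrow> real \<Rightarrow> bool" where
  "unit_speed_curve A h J \<gamma> \<epsilon> \<longleftrightarrow> smooth_curve A J \<gamma> \<and> \<epsilon> \<in> {1, -1} \<and>
     (\<forall>s\<in>J. \<forall>c\<in>A. \<gamma> s \<in> dom_chart c \<longrightarrow>
        h c (\<gamma> s) (velocity J \<gamma> c s) (velocity J \<gamma> c s) = \<epsilon>)"

abbreviation spacelike_curve ::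
  "'m::topological_space chart set \<Rightarrow> 'm bilin_field \<Rightarrow> real set \<Rightarrow> (real \<Rightarrow> 'm) \<Rightarrow> bool" where
  "spacelike_curve A h J \<gamma> \<equiv> unit_speed_curve A h J \<gamma> 1"

definition slant_wrt_metric ::
  "'m chart set \<Rightarrow> 'm bilin_field \<Rightarrow> 'm vec_field \<Rightarrow> real set \<Rightarrow> (real \<Rightarrow> 'm) \<Rightarrow> real \<Rightarrow> bool" where
  "slant_wrt_metric A h \<xi> J \<gamma> a \<longleftrightarrow>
     (\<forall>s\<in>J. \<forall>c\<in>A. \<gamma> s \<in> dom_chart c \<longrightarrow> h c (\<gamma> s) (velocity J \<gamma> c s) (\<xi> c (\<gamma> s)) = a)"

text \<open>An orthonormal frame \<open>E1 = \<gamma>', E2, E3\<close> of causal types \<open>\<epsilon>1, \<epsilon>2, \<epsilon>3 = - \<epsilon>1 \<epsilon>2\<close> satisfying the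
  Frenet equations with coefficients \<open>k\<close> and \<open>\<tau>\<close>, whose signs are not yet restricted.\<close>

definition frenet_frame ::
  "'m::topological_space chart set \<Rightarrow> 'm bilin_field \<Rightarrow> 'm conn \<Rightarrow> real set \<Rightarrow> (real \<Rightarrow> 'm) \<Rightarrow>
   real \<Rightarrow> real \<Rightarrow> real \<Rightarrow> 'm field_along \<Rightarrow> 'm field_along \<Rightarrow> 'm field_along \<Rightarrow>
   (real \<Rightarrow> real) \<Rightarrow> (real \<Rightarrow> real) \<Rightarrow> bool" where
  "frenet_frame A h \<Gamma> J \<gamma> \<epsilon>1 \<epsilon>2 \<epsilon>3 E1 E2 E3 k \<tau> \<longleftrightarrow>
     unit_speed_curve A h J \<gamma> \<epsilon>1 \<and> \<epsilon>2 \<in> {1, -1} \<and> \<epsilon>3 = - \<epsilon>1 * \<epsilon>2 \<and>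
     smooth_field_along A J \<gamma> E1 \<and> smooth_field_along A J \<gamma> E2 \<and> smooth_field_along A J \<gamma> E3 \<and>
     (\<forall>s\<in>J. \<forall>c\<in>A. \<gamma> s \<in> dom_chart c \<longrightarrow>
        E1 c s = velocity J \<gamma> c s \<and>
        h c (\<gamma> s) (E1 c s) (E1 c s) = \<epsilon>1 \<and>
        h c (\<gamma> s) (E2 c s) (E2 c s) = \<epsilon>2 \<and>
        h c (\<gamma> s) (E3 c s) (E3 c s) = \<epsilon>3 \<and>
        h c (\<gamma> s) (E1 c s) (E2 c s) = 0 \<and>
        h c (\<gamma> s) (E1 c s) (E3 c s) = 0 \<and>
        h c (\<gamma> s) (E2 c s) (E3 c s) = 0 \<and>
        cov_deriv_along \<Gamma> J \<gamma> E1 c s = (\<epsilon>2 * k s) *\<^sub>R E2 c s \<and>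
        cov_deriv_along \<Gamma> J \<gamma> E2 c s = (- \<epsilon>1 * k s) *\<^sub>R E1 c s + (\<epsilon>3 * \<tau> s) *\<^sub>R E3 c s \<and>
        cov_deriv_along \<Gamma> J \<gamma> E3 c s = (- \<epsilon>2 * \<tau> s) *\<^sub>R E2 c s)"

definition frenet_apparatus3 ::
  "'m::topological_space chart set \<Rightarrow> 'm bilin_field \<Rightarrow> 'm conn \<Rightarrow> real set \<Rightarrow> (real \<Rightarrow> 'm) \<Rightarrow>
   real \<Rightarrow> real \<Rightarrow> real \<Rightarrow> 'm field_along \<Rightarrow> 'm field_along \<Rightarrow> 'm field_along \<Rightarrow>
   (real \<Rightarrow> real) \<Rightarrow> (real \<Rightarrow> real) \<Rightarrow> bool" where
  "frenet_apparatus3 A h \<Gamma> J \<gamma> \<epsilon>1 \<epsilon>2 \<epsilon>3 E1 E2 E3 k \<tau> \<longleftrightarrow>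
     frenet_frame A h \<Gamma> J \<gamma> \<epsilon>1 \<epsilon>2 \<epsilon>3 E1 E2 E3 k \<tau> \<and> (\<forall>s\<in>J. k s > 0 \<and> \<tau> s > 0)"

definition frenet_curve3 ::
  "'m::topological_space chart set \<Rightarrow> 'm bilin_field \<Rightarrow> 'm conn \<Rightarrow> real set \<Rightarrow> (real \<Rightarrow> 'm) \<Rightarrow> bool" where
  "frenet_curve3 A h \<Gamma> J \<gamma> \<longleftrightarrow>
     (\<exists>\<epsilon>1 \<epsilon>2 \<epsilon>3 E1 E2 E3 k \<tau>. frenet_apparatus3 A h \<Gamma> J \<gamma> \<epsilon>1 \<epsilon>2 \<epsilon>3 E1 E2 E3 k \<tau>)"

text \<open>Helices and pseudo-circles are Frenet curves in the wider sense in which the torsion may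
  vanish. For vanishing torsion, \<open>E3\<close> merely completes \<open>E1, E2\<close> to an orthonormal frame.\<close>

definition helix ::
  "'m::topological_space chart set \<Rightarrow> 'm bilin_field \<Rightarrow> 'm conn \<Rightarrow> real set \<Rightarrow> (real \<Rightarrow> 'm) \<Rightarrow> bool" where
  "helix A h \<Gamma> J \<gamma> \<longleftrightarrow>
     (\<exists>\<epsilon>1 \<epsilon>2 \<epsilon>3 E1 E2 E3 k0 \<tau>0. k0 > 0 \<and> \<tau>0 \<ge> 0 \<and>
        frenet_frame A h \<Gamma> J \<gamma> \<epsilon>1 \<epsilon>2 \<epsilon>3 E1 E2 E3 (\<lambda>_. k0) (\<lambda>_. \<tau>0))"

definition pseudo_circle ::
  "'m::topological_space chart set \<Rightarrow> 'm bilin_field \<Rightarrow> 'm conn \<Rightarrow> real set \<Rightarrow> (real \<Rightarrow> 'm) \<Rightarrow> bool" where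
  "pseudo_circle A h \<Gamma> J \<gamma> \<longleftrightarrow>
     (\<exists>\<epsilon>1 \<epsilon>2 \<epsilon>3 E1 E2 E3 k0. k0 > 0 \<and>
        frenet_frame A h \<Gamma> J \<gamma> \<epsilon>1 \<epsilon>2 \<epsilon>3 E1 E2 E3 (\<lambda>_. k0) (\<lambda>_. 0))"

definition proper_helix ::
  "'m::topological_space chart set \<Rightarrow> 'm bilin_field \<Rightarrow> 'm conn \<Rightarrow> real set \<Rightarrow> (real \<Rightarrow> 'm) \<Rightarrow> bool" where
  "proper_helix A h \<Gamma> J \<gamma> \<longleftrightarrow> helix A h \<Gamma> J \<gamma> \<and> \<not> pseudo_circle A h \<Gamma> J \<gamma>"

end

theory Submission
  imports Defs
begin

text \<open>Along the curve, \<open>C'\<close>, \<open>\<phi> C'\<close> and \<open>\<xi>\<close> form a basis of the tangent space, because a null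
  vector is not a multiple of \<open>\<xi>\<close> and \<open>\<phi>\<close> has no real eigenvalue modulo \<open>\<xi>\<close> (\<open>null_basis\<close>). The
  inner products of these three vectors are all known in terms of \<open>a\<close>; in particular \<open>a = 0\<close> would
  make \<open>C'\<close> orthogonal to everything (\<open>null_eta_nonzero\<close>). Differentiating the three constants
  \<open>g(C', C') = 0\<close>, \<open>\<eta>(C') = a\<close> and \<open>g(C', \<phi> C') = 0\<close> gives the inner products of \<open>\<nabla> C'/dt\<close> with
  the basis and hence \<open>\<nabla> C'/dt = - a \<phi> C'\<close> (\<open>acceleration\<close>). The derivative of \<open>\<phi>\<close> and
  \<open>\<nabla>\<^sub>u \<xi> = - \<phi> u\<close> (\<open>nabla_xi\<close>) then yield the derivatives of \<open>\<phi> C'\<close> and \<open>\<xi>\<close> along the curve.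

  The connection of the associated metric differs from \<open>\<nabla>\<close> by an explicit multiple of \<open>\<xi>\<close>
  (\<open>associated_connection\<close>), so its covariant derivatives of the same fields are known as well. Since
  the associated metric gives \<open>C'\<close> the constant square \<open>a\<^sup>2\<close>, the arc length is an affine function of
  \<open>t\<close> (\<open>arc_length_affine\<close>), and the curve \<open>\<gamma>\<close> parametrized by it is again a null slant curve
  for \<open>g\<close>, now with \<open>\<eta>(\<gamma>') = e\<close>, the sign of \<open>a\<close> (\<open>affine_reparametrization\<close>). For \<open>\<gamma>\<close> the Frenet
  equations with curvature and torsion 1 are a direct computation with \<open>e\<^sup>2 = 1\<close>
  (\<open>frenet_equations\<close>, \<open>associated_frenet_frame\<close>).

  For the frame to be smooth, and for the Leibniz rules along the curve, the class \<open>Ck_on\<close> has to be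
  closed under sums, products and composition, on open sets as well as on pieces of intervals.\<close>

section \<open>Linear algebra of a tangent space\<close>

locale contact_B_space =
  fixes \<phi> :: "real^3 \<Rightarrow> real^3" and \<xi> :: "real^3" and \<eta> :: "real^3 \<Rightarrow> real"
    and g :: "real^3 \<Rightarrow> real^3 \<Rightarrow> real"
  assumes linear_phi: "linear \<phi>" and linear_eta: "linear \<eta>" and bilinear_metric: "bilinear g"
    and metric_sym: "g u v = g v u" and metric_nondeg: "(\<And>w. g v w = 0) \<Longrightarrow> v = 0"
    and phi_phi: "\<phi> (\<phi> u) = - u + \<eta> u *\<^sub>R \<xi>" and eta_xi: "\<eta> \<xi> = 1"
    and metric_phi_phi: "g (\<phi> u) (\<phi> v) = - g u v + \<eta> u * \<eta> v"
begin

lemmas phi_simps = linear_add[OF linear_phi] linear_diff[OF linear_phi] linear_neg[OF linear_phi]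
  linear_scale[OF linear_phi] linear_0[OF linear_phi]

lemmas eta_simps = linear_add[OF linear_eta] linear_diff[OF linear_eta] linear_neg[OF linear_eta]
  linear_scale[OF linear_eta] linear_0[OF linear_eta]

lemmas metric_simps = bilinear_ladd[OF bilinear_metric] bilinear_radd[OF bilinear_metric]
  bilinear_lsub[OF bilinear_metric] bilinear_rsub[OF bilinear_metric]
  bilinear_lneg[OF bilinear_metric] bilinear_rneg[OF bilinear_metric]
  bilinear_lmul[OF bilinear_metric] bilinear_rmul[OF bilinear_metric]
  bilinear_lzero[OF bilinear_metric] bilinear_rzero[OF bilinear_metric]

lemma xi_nonzero: "\<xi> \<noteq> 0"
  using eta_xi eta_simps by force

text \<open>Since \<open>\<phi> (\<phi> \<xi>) = 0\<close>, the formula for \<open>\<phi> \<circ> \<phi>\<close> at \<open>\<phi> \<xi>\<close> makes \<open>\<phi> \<xi>\<close> a multiple of \<open>\<xi>\<close>;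
  a nonzero factor would contradict \<open>\<phi> (\<phi> \<xi>) = 0\<close>.\<close>

lemma phi_xi: "\<phi> \<xi> = 0"
proof -
  have "\<phi> (\<phi> \<xi>) = 0"
    by (simp add: phi_phi eta_xi)
  then have eq: "\<phi> \<xi> = \<eta> (\<phi> \<xi>) *\<^sub>R \<xi>"
    using phi_phi[of "\<phi> \<xi>"] by (simp add: phi_simps)
  then have "\<phi> (\<phi> \<xi>) = (\<eta> (\<phi> \<xi>) * \<eta> (\<phi> \<xi>)) *\<^sub>R \<xi>"
    by (metis phi_simps(4) scaleR_scaleR)
  with \<open>\<phi> (\<phi> \<xi>) = 0\<close> have "\<eta> (\<phi> \<xi>) = 0"
    using xi_nonzero by simp
  with eq show ?thesis
    by simp
qed

text \<open>Compare the two ways of evaluating \<open>\<phi> (\<phi> (\<phi> u))\<close>.\<close>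

lemma eta_phi: "\<eta> (\<phi> u) = 0"
proof -
  have "\<phi> (\<phi> (\<phi> u)) = - \<phi> u"
    by (simp add: phi_phi[of u] phi_simps phi_xi)
  then show ?thesis
    using phi_phi[of "\<phi> u"] xi_nonzero by simp
qed

lemma metric_xi: "g u \<xi> = \<eta> u" "g \<xi> u = \<eta> u"
  using metric_phi_phi[of u \<xi>] by (simp_all add: phi_xi metric_simps eta_xi metric_sym[of \<xi>])

lemma metric_phi_swap: "g (\<phi> u) v = g u (\<phi> v)"
proof -
  have "g (\<phi> u) (\<phi> (\<phi> v)) = - g u (\<phi> v)"
    by (simp add: metric_phi_phi eta_phi)
  then show ?thesis
    by (simp add: phi_phi metric_simps metric_xi eta_phi)
qed

text \<open>The associated metric inherits non-degeneracy: a vector in its radical lies in the kernel of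
  \<open>\<eta>\<close> (test against \<open>\<xi>\<close>) and in the kernel of \<open>\<phi>\<close>, whose intersection is zero because
  \<open>\<phi>\<close> squares to minus the identity on the kernel of \<open>\<eta>\<close>.\<close>

lemma associated_nondeg:
  assumes "\<And>w. g v (\<phi> w) + \<eta> v * \<eta> w = 0"
  shows "v = 0"
proof -
  have "\<eta> v = 0"
    using assms[of \<xi>] by (simp add: phi_xi metric_simps eta_xi)
  then have "\<phi> v = 0"
    using assms by (intro metric_nondeg) (simp add: metric_phi_swap)
  then show ?thesis
    using phi_phi[of v] \<open>\<eta> v = 0\<close> by (simp add: phi_simps)
qed

text \<open>A null vector \<open>v\<close> is not a multiple of \<open>\<xi>\<close>, so \<open>\<phi> v\<close> does not vanish; \<open>v\<close>, \<open>\<phi> v\<close> and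
  \<open>\<xi>\<close> are then a basis, because \<open>\<phi>\<close> acts on the quotient by \<open>\<xi>\<close> without real eigenvalues.\<close>

lemma null_basis:
  assumes "g v v = 0" "v \<noteq> 0"
  obtains x y w where "u = x *\<^sub>R v + y *\<^sub>R \<phi> v + w *\<^sub>R \<xi>"
proof -
  have phi_v: "\<phi> v \<noteq> 0"
  proof
    assume "\<phi> v = 0"
    then have v: "v = \<eta> v *\<^sub>R \<xi>"
      using phi_phi[of v] by (simp add: phi_simps)
    then have "g v v = \<eta> v * \<eta> v"
      using metric_simps(7)[of "\<eta> v" \<xi> v] by (simp add: metric_xi)
    with assms(1) v show False
      using assms(2) by simp
  qed
  have indep: "x = 0 \<and> y = 0 \<and> w = 0" if "x *\<^sub>R v + y *\<^sub>R \<phi> v + w *\<^sub>R \<xi> = 0" for x y w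
  proof -
    have 1: "x *\<^sub>R \<phi> v + y *\<^sub>R \<phi> (\<phi> v) = 0"
      using arg_cong[OF that, of \<phi>] by (simp add: phi_simps phi_xi)
    then have "x *\<^sub>R \<phi> (\<phi> v) + y *\<^sub>R \<phi> (\<phi> (\<phi> v)) = 0"
      by (metis phi_simps(1,4,5))
    then have 2: "x *\<^sub>R \<phi> (\<phi> v) = y *\<^sub>R \<phi> v"
      by (simp add: phi_phi[of "\<phi> v"] eta_phi)
    have "x *\<^sub>R (x *\<^sub>R \<phi> v + y *\<^sub>R \<phi> (\<phi> v)) = (x * x) *\<^sub>R \<phi> v + y *\<^sub>R (x *\<^sub>R \<phi> (\<phi> v))"
      by (simp add: scaleR_add_right mult.commute)
    also have "\<dots> = (x * x + y * y) *\<^sub>R \<phi> v"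
      by (simp add: 2 scaleR_add_left)
    finally have "(x * x + y * y) *\<^sub>R \<phi> v = 0"
      by (simp add: 1)
    then have "x * x + y * y = 0"
      using phi_v by simp
    then have "x = 0" "y = 0"
      by (simp_all add: sum_squares_eq_zero_iff)
    with that xi_nonzero show ?thesis
      by simp
  qed
  have ne: "v \<noteq> \<phi> v" "v \<noteq> \<xi>" "\<phi> v \<noteq> \<xi>"
    using indep[of 1 "-1" 0] indep[of 1 0 "-1"] indep[of 0 1 "-1"] by auto
  have "independent {v, \<phi> v, \<xi>}"
    unfolding independent_explicit
  proof (intro conjI allI impI)
    fix k :: "real^3 \<Rightarrow> real"
    assume "(\<Sum>b\<in>{v, \<phi> v, \<xi>}. k b *\<^sub>R b) = 0"
    then have "k v *\<^sub>R v + k (\<phi> v) *\<^sub>R \<phi> v + k \<xi> *\<^sub>R \<xi> = 0"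
      using ne by (simp add: add.assoc)
    from indep[OF this] show "\<forall>b\<in>{v, \<phi> v, \<xi>}. k b = 0"
      by simp
  qed simp
  then have "UNIV \<subseteq> span {v, \<phi> v, \<xi>}"
    using ne by (intro card_ge_dim_independent) auto
  then have "u \<in> span {v, \<phi> v, \<xi>}"
    by blast
  then obtain x y w where "u - x *\<^sub>R v - y *\<^sub>R \<phi> v = w *\<^sub>R \<xi>"
    by (auto simp: span_insert span_singleton)
  then have "u = x *\<^sub>R v + y *\<^sub>R \<phi> v + w *\<^sub>R \<xi>"
    by (simp add: algebra_simps)
  with that show thesis .
qed

lemma null_nondeg:
  assumes "g v v = 0" "v \<noteq> 0" "g u v = 0" "g u (\<phi> v) = 0" "\<eta> u = 0"
  shows "u = 0"
proof (rule metric_nondeg)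
  fix w
  obtain x y r where "w = x *\<^sub>R v + y *\<^sub>R \<phi> v + r *\<^sub>R \<xi>"
    using null_basis[OF assms(1,2)] .
  then show "g u w = 0"
    using assms by (simp add: metric_simps metric_xi)
qed

text \<open>If \<open>\<eta> v\<close> vanished, \<open>v\<close> would be orthogonal to the whole basis \<open>v, \<phi> v, \<xi>\<close>.\<close>

lemma null_eta_nonzero:
  assumes "g v v = 0" "v \<noteq> 0" "g v (\<phi> v) = 0"
  shows "\<eta> v \<noteq> 0"
  using null_nondeg[OF assms(1,2) assms(1,3)] assms(2) by blast

end

section \<open>Calculus of maps of class \<open>Ck\<close>\<close>

text \<open>On a solid set every point can be approached along each coordinate axis, which makes the
  derivative within the set unique. Open sets and relatively open pieces of nondegenerate intervals
  are both solid, so the rules below serve for tensor fields in charts and for curves.\<close>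

definition solid :: "'a::euclidean_space set \<Rightarrow> bool" where
  "solid S \<longleftrightarrow> (\<forall>x\<in>S. \<forall>i\<in>Basis. \<forall>e>0. \<exists>d. 0 < \<bar>d\<bar> \<and> \<bar>d\<bar> < e \<and> x + d *\<^sub>R i \<in> S)"

lemma solid_has_derivative_unique:
  assumes "solid S" "x \<in> S" "(f has_derivative D) (at x within S)"
  shows "frechet_derivative f (at x within S) = D"
proof -
  have "(f has_derivative frechet_derivative f (at x within S)) (at x within S)"
    using assms(3) differentiableI frechet_derivative_works by blast
  then show ?thesis
    by (rule frechet_derivative_unique_within[OF _ assms(3)])
      (use assms(1,2) in \<open>auto simp: solid_def\<close>)
qed

lemma solid_open: "solid S" if S: "open S" for S :: "'a::euclidean_space set"
  unfolding solid_def
proof (intro ballI allI impI)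
  fix x i :: 'a and e :: real
  assume "x \<in> S" "i \<in> Basis" "e > 0"
  obtain r where r: "r > 0" "ball x r \<subseteq> S"
    by (rule openE[OF S \<open>x \<in> S\<close>])
  define m where "m = min r e / 2"
  have m: "0 < m" "m < r" "m < e"
    using r(1) \<open>e > 0\<close> by (auto simp: m_def min_def)
  then have "x + m *\<^sub>R i \<in> ball x r"
    using \<open>i \<in> Basis\<close> by (simp add: dist_norm)
  with m r(2) have "0 < \<bar>m\<bar> \<and> \<bar>m\<bar> < e \<and> x + m *\<^sub>R i \<in> S"
    by auto
  then show "\<exists>d. 0 < \<bar>d\<bar> \<and> \<bar>d\<bar> < e \<and> x + d *\<^sub>R i \<in> S"
    by blast
qed

lemma solid_interval_Int_open:
  fixes I :: "real set"
  assumes I: "is_interval I" "p \<in> I" "q \<in> I" "p < q" and "open U"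
  shows "solid (I \<inter> U)"
  unfolding solid_def
proof (intro ballI allI impI)
  fix x i e :: real
  assume x: "x \<in> I \<inter> U" and i: "i \<in> Basis" and "e > 0"
  obtain y where y: "y \<in> I" "y \<noteq> x"
    using I by (cases "x = p") auto
  obtain r where r: "r > 0" "ball x r \<subseteq> U"
    using openE[OF \<open>open U\<close>, of x] x by auto
  define m where "m = min (min r e) \<bar>y - x\<bar> / 2"
  have m: "0 < m" "m < r" "m < e" "m < \<bar>y - x\<bar>"
    using r(1) \<open>e > 0\<close> y(2) by (auto simp: m_def min_def)
  define d where "d = (if y > x then m else - m)"
  have "x + d \<in> I"
    using mem_is_interval_1_I[OF I(1), of x y "x + d"] mem_is_interval_1_I[OF I(1), of y x "x + d"]
      x y m by (auto simp: d_def split: if_splits)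
  moreover have "x + d \<in> U"
    using m by (intro subsetD[OF r(2)]) (auto simp: d_def dist_norm)
  ultimately have "0 < \<bar>d\<bar> \<and> \<bar>d\<bar> < e \<and> x + d *\<^sub>R i \<in> I \<inter> U"
    using m i by (auto simp: d_def)
  then show "\<exists>d. 0 < \<bar>d\<bar> \<and> \<bar>d\<bar> < e \<and> x + d *\<^sub>R i \<in> I \<inter> U"
    by blast
qed

lemma Ck_on_cong:
  assumes "\<And>x. x \<in> S \<Longrightarrow> f x = g x"
  shows "Ck_on k S f \<longleftrightarrow> Ck_on k S g"
  using assms
proof (induction k arbitrary: f g)
  case 0
  then show ?case
    by (simp cong: continuous_on_cong)
next
  case (Suc k)
  have D: "(f has_derivative F) (at x within S) \<longleftrightarrow> (g has_derivative F) (at x within S)"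
    if "x \<in> S" for x F
    using that Suc.prems by (intro iffI; elim has_derivative_transform[rotated 2]) auto
  have "Ck_on k S (\<lambda>x. frechet_derivative f (at x within S) v) \<longleftrightarrow>
      Ck_on k S (\<lambda>x. frechet_derivative g (at x within S) v)" for v
    by (rule Suc.IH) (simp add: frechet_derivative_def D)
  then show ?case
    using D by (simp add: differentiable_def)
qed

text \<open>Any derivative may be used to establish the class, not only the one that the choice operator
  behind \<open>frechet_derivative\<close> returns.\<close>

lemma Ck_on_SucI:
  assumes "solid S" and D: "\<And>x. x \<in> S \<Longrightarrow> (f has_derivative D x) (at x within S)"
    and "\<And>v. Ck_on k S (\<lambda>x. D x v)"
  shows "Ck_on (Suc k) S f"
proof -
  have "Ck_on k S (\<lambda>x. frechet_derivative f (at x within S) v) \<longleftrightarrow> Ck_on k S (\<lambda>x. D x v)" for v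
    by (rule Ck_on_cong) (simp add: solid_has_derivative_unique[OF assms(1) _ D])
  then show ?thesis
    using assms(3) D by (auto simp: differentiable_def)
qed

lemma Ck_on_Suc_has_derivative:
  assumes "Ck_on (Suc k) S f" "x \<in> S"
  shows "(f has_derivative frechet_derivative f (at x within S)) (at x within S)"
  using assms by (auto simp: frechet_derivative_works[symmetric])

lemma Ck_on_SucD: "Ck_on (Suc k) S f \<Longrightarrow> Ck_on k S f"
proof (induction k arbitrary: f)
  case 0
  then show ?case
    by (auto simp: continuous_on_eq_continuous_within differentiable_imp_continuous_within)
next
  case (Suc k)
  then show ?case
    by (metis Ck_on.simps(2))
qed

lemma linear_basis_expansion:
  fixes L :: "'a::euclidean_space \<Rightarrow> 'b::real_vector"
  assumes "linear L"
  shows "L v = (\<Sum>i\<in>Basis. (v \<bullet> i) *\<^sub>R L i)"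
proof -
  have "L v = L (\<Sum>i\<in>Basis. (v \<bullet> i) *\<^sub>R i)"
    by (simp add: euclidean_representation)
  then show ?thesis
    by (simp add: linear_sum[OF assms] linear_scale[OF assms])
qed

lemma Ck_on_const:
  assumes "solid S"
  shows "Ck_on k S (\<lambda>_. a)"
proof (induction k arbitrary: a)
  case (Suc k)
  show ?case
    by (rule Ck_on_SucI[OF assms, where D = "\<lambda>_ _. 0"]) (use Suc in auto)
qed simp

lemma Ck_on_linear_map:
  assumes "solid S" "bounded_linear L"
  shows "Ck_on k S L"
proof (cases k)
  case 0
  then show ?thesis
    by (simp add: linear_continuous_on[OF assms(2)])
next
  case (Suc n)
  show ?thesis
    unfolding Suc
    by (rule Ck_on_SucI[OF assms(1) bounded_linear_imp_has_derivative[OF assms(2)]])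
      (rule Ck_on_const[OF assms(1)])
qed

lemma Ck_on_add:
  assumes "solid S" "Ck_on k S f" "Ck_on k S g"
  shows "Ck_on k S (\<lambda>x. f x + g x)"
  using assms(2,3)
proof (induction k arbitrary: f g)
  case (Suc k)
  show ?case
  proof (rule Ck_on_SucI[OF assms(1)])
    fix x assume "x \<in> S"
    then show "((\<lambda>x. f x + g x) has_derivative (\<lambda>v. frechet_derivative f (at x within S) v +
        frechet_derivative g (at x within S) v)) (at x within S)"
      using Suc.prems by (intro has_derivative_add Ck_on_Suc_has_derivative)
  qed (use Suc in simp)
qed (auto intro: continuous_intros)

lemma Ck_on_sum:
  assumes "solid S" "\<And>i. i \<in> B \<Longrightarrow> Ck_on k S (f i)"
  shows "Ck_on k S (\<lambda>x. \<Sum>i\<in>B. f i x)"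
  using assms(2) by (induction B rule: infinite_finite_induct)
    (auto intro: Ck_on_add Ck_on_const assms(1))

lemma Ck_on_bounded_linear:
  assumes "solid S" "bounded_linear L" "Ck_on k S f"
  shows "Ck_on k S (\<lambda>x. L (f x))"
  using assms(3)
proof (induction k arbitrary: f)
  case 0
  then show ?case
    using bounded_linear.continuous_on[OF assms(2)] by simp
next
  case (Suc k)
  show ?case
  proof (rule Ck_on_SucI[OF assms(1)])
    fix x assume "x \<in> S"
    then show "((\<lambda>x. L (f x)) has_derivative (\<lambda>v. L (frechet_derivative f (at x within S) v)))
        (at x within S)"
      using Suc.prems by (intro bounded_linear.has_derivative[OF assms(2)] Ck_on_Suc_has_derivative)
  qed (use Suc in simp)
qed

lemma Ck_on_scaleR:
  assumes "solid S" "Ck_on k S r" "Ck_on k S f"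
  shows "Ck_on k S (\<lambda>x. r x *\<^sub>R f x)"
  using assms(2,3)
proof (induction k arbitrary: r f)
  case (Suc k)
  show ?case
  proof (rule Ck_on_SucI[OF assms(1)])
    fix x assume "x \<in> S"
    then show "((\<lambda>x. r x *\<^sub>R f x) has_derivative
        (\<lambda>v. r x *\<^sub>R frechet_derivative f (at x within S) v +
          frechet_derivative r (at x within S) v *\<^sub>R f x)) (at x within S)"
      using Suc.prems by (intro has_derivative_scaleR Ck_on_Suc_has_derivative)
  qed (use Suc Suc.prems[THEN Ck_on_SucD] in \<open>auto intro!: Ck_on_add assms(1)\<close>)
qed (auto intro: continuous_intros)

text \<open>The derivative of a composition, \<open>D g (f x) (D f x v)\<close>, is a sum over the basis of products
  of a coordinate of \<open>D f x v\<close> and a partial derivative of \<open>g\<close> composed with \<open>f\<close>, so that the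
  induction hypothesis applies to the latter.\<close>

lemma Ck_on_compose:
  fixes f :: "'a::euclidean_space \<Rightarrow> 'b::euclidean_space"
  assumes "solid S" "Ck_on k S f" "Ck_on k T g" "f ` S \<subseteq> T"
  shows "Ck_on k S (\<lambda>x. g (f x))"
  using assms(2,3)
proof (induction k arbitrary: g)
  case 0
  then show ?case
    using assms(4) by (auto intro: continuous_on_compose2)
next
  case (Suc k)
  let ?f' = "\<lambda>x. frechet_derivative f (at x within S)"
  let ?g' = "\<lambda>y. frechet_derivative g (at y within T)"
  show ?case
  proof (rule Ck_on_SucI[OF assms(1)])
    fix x assume x: "x \<in> S"
    have f': "(f has_derivative ?f' x) (at x within S)"
      using Suc.prems(1) x by (rule Ck_on_Suc_has_derivative)
    have g': "(g has_derivative ?g' (f x)) (at (f x) within T)"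
      using Suc.prems(2) x assms(4) by (intro Ck_on_Suc_has_derivative) auto
    have "((\<lambda>x. g (f x)) has_derivative (\<lambda>v. ?g' (f x) (?f' x v))) (at x within S)"
      using has_derivative_in_compose[OF f' has_derivative_subset[OF g' assms(4)]] .
    also have "(\<lambda>v. ?g' (f x) (?f' x v)) = (\<lambda>v. \<Sum>i\<in>Basis. (?f' x v \<bullet> i) *\<^sub>R ?g' (f x) i)"
      by (intro ext linear_basis_expansion has_derivative_linear[OF g'])
    finally show "((\<lambda>x. g (f x)) has_derivative
        (\<lambda>v. \<Sum>i\<in>Basis. (?f' x v \<bullet> i) *\<^sub>R ?g' (f x) i)) (at x within S)" .
  next
    fix v
    have "Ck_on k S (\<lambda>x. ?g' (f x) i)" for i
      using Suc.prems(2)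
      by (intro Suc.IH[where g = "\<lambda>y. ?g' y i"] Ck_on_SucD[OF Suc.prems(1)]) simp
    then show "Ck_on k S (\<lambda>x. \<Sum>i\<in>Basis. (?f' x v \<bullet> i) *\<^sub>R ?g' (f x) i)"
      using Suc.prems(1)
      by (intro Ck_on_sum Ck_on_scaleR assms(1) Ck_on_bounded_linear[OF _ bounded_linear_inner_left])
        auto
  qed
qed

text \<open>This covers a tensor field applied to a vector field: only the components \<open>B x v\<close> with constant
  \<open>v\<close> are given to be of class \<open>Ck\<close>, and expanding \<open>F x\<close> in the basis reduces the claim to them.\<close>

lemma Ck_on_linear_family:
  fixes F :: "'a::euclidean_space \<Rightarrow> 'b::euclidean_space"
  assumes "solid S" "\<And>x. x \<in> S \<Longrightarrow> linear (B x)" "\<And>v. Ck_on k S (\<lambda>x. B x v)" "Ck_on k S F"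
  shows "Ck_on k S (\<lambda>x. B x (F x))"
proof -
  have "Ck_on k S (\<lambda>x. \<Sum>i\<in>Basis. (F x \<bullet> i) *\<^sub>R B x i)"
    using assms
    by (intro Ck_on_sum Ck_on_scaleR Ck_on_bounded_linear[OF _ bounded_linear_inner_left]) auto
  then show ?thesis
    by (rule Ck_on_cong[THEN iffD1, rotated]) (simp add: linear_basis_expansion[symmetric] assms(2))
qed

section \<open>Differentiation in a chart\<close>

lemma param_coords: "is_chart c \<Longrightarrow> p \<in> dom_chart c \<Longrightarrow> param c (coords c p) = p"
  unfolding is_chart_def by (meson homeomorphism_apply1)

lemma coords_in_img: "p \<in> dom_chart c \<Longrightarrow> coords c p \<in> img_chart c"
  by (simp add: img_chart_def)

lemma param_in_dom: "is_chart c \<Longrightarrow> x \<in> img_chart c \<Longrightarrow> param c x \<in> dom_chart c"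
  unfolding is_chart_def using homeomorphism_image2 by blast

lemma open_img_chart: "is_chart c \<Longrightarrow> open (img_chart c)"
  by (simp add: is_chart_def)

lemma solid_img_chart: "is_chart c \<Longrightarrow> solid (img_chart c)"
  by (simp add: solid_open open_img_chart)

lemma smooth_in_chart_const: "is_chart c \<Longrightarrow> smooth_in_chart c (\<lambda>_. v)"
  by (simp add: smooth_in_chart_def smooth_on_def Ck_on_const solid_img_chart)

lemma smooth_in_chart_linear_family:
  fixes F :: "'m::topological_space \<Rightarrow> 'b::euclidean_space"
  assumes "is_chart c" "\<And>q. q \<in> dom_chart c \<Longrightarrow> linear (B q)"
    and "\<And>v. smooth_in_chart c (\<lambda>q. B q v)" "smooth_in_chart c F"
  shows "smooth_in_chart c (\<lambda>q. B q (F q))"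
  unfolding smooth_in_chart_def smooth_on_def
proof
  fix k
  show "Ck_on k (img_chart c) (\<lambda>x. B (param c x) (F (param c x)))"
  proof (rule Ck_on_linear_family)
    show "Ck_on k (img_chart c) (\<lambda>x. B (param c x) v)" for v
      using assms(3) by (simp add: smooth_in_chart_def smooth_on_def)
    show "Ck_on k (img_chart c) (\<lambda>x. F (param c x))"
      using assms(4) by (simp add: smooth_in_chart_def smooth_on_def)
  qed (use assms(1,2) in \<open>auto intro: solid_img_chart param_in_dom\<close>)
qed

lemma chart_deriv_frechet:
  "chart_deriv c f p = frechet_derivative (\<lambda>x. f (param c x)) (at (coords c p))"
  by (simp add: fun_eq_iff chart_deriv_def)

lemma chart_has_derivative:
  assumes "is_chart c" "smooth_in_chart c f" "p \<in> dom_chart c"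
  shows "((\<lambda>x. f (param c x)) has_derivative chart_deriv c f p) (at (coords c p))"
proof -
  have "Ck_on (Suc 0) (img_chart c) (\<lambda>x. f (param c x))"
    using assms(2) unfolding smooth_in_chart_def smooth_on_def by blast
  from Ck_on_Suc_has_derivative[OF this coords_in_img[OF assms(3)]] show ?thesis
    by (simp add: at_within_open[OF coords_in_img[OF assms(3)] open_img_chart[OF assms(1)]]
        chart_deriv_frechet)
qed

lemma chart_deriv_linear:
  "is_chart c \<Longrightarrow> smooth_in_chart c f \<Longrightarrow> p \<in> dom_chart c \<Longrightarrow> linear (chart_deriv c f p)"
  by (rule has_derivative_linear[OF chart_has_derivative])

lemma chart_deriv_eq:
  assumes "((\<lambda>x. f (param c x)) has_derivative D) (at (coords c p))"
  shows "chart_deriv c f p = D"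
  unfolding chart_deriv_frechet using frechet_derivative_at[OF assms] by simp

lemma chart_deriv_const [simp]: "chart_deriv c (\<lambda>_. v) p u = 0"
  by (simp add: chart_deriv_eq[of "\<lambda>_. v" c "\<lambda>_. 0"])

lemma chart_deriv_cong:
  assumes "is_chart c" "p \<in> dom_chart c" "\<And>q. q \<in> dom_chart c \<Longrightarrow> f q = f' q"
  shows "chart_deriv c f p = chart_deriv c f' p"
proof -
  have "((\<lambda>x. f (param c x)) has_derivative D) (at (coords c p)) \<longleftrightarrow>
      ((\<lambda>x. f' (param c x)) has_derivative D) (at (coords c p))" for D
    using assms(3) param_in_dom[OF assms(1)]
    by (intro iffI; elim has_derivative_transform_within_open[OF _ open_img_chart[OF assms(1)]
          coords_in_img[OF assms(2)]]) auto
  then show ?thesis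
    by (simp add: chart_deriv_frechet frechet_derivative_def)
qed

lemma atlas_is_chart: "smooth_atlas A \<Longrightarrow> c \<in> A \<Longrightarrow> is_chart c"
  by (simp add: smooth_atlas_def)

text \<open>The transition map is smooth on the image of the overlap, which is open because \<open>coords c\<close> is a
  homeomorphism; hence it is differentiable in the ordinary sense there.\<close>

lemma jac_has_derivative:
  assumes A: "smooth_atlas A" and c: "c \<in> A" "c' \<in> A" and p: "p \<in> dom_chart c" "p \<in> dom_chart c'"
  shows "((\<lambda>x. coords c' (param c x)) has_derivative jac c c' p) (at (coords c p))"
proof -
  let ?S = "coords c ` (dom_chart c \<inter> dom_chart c')"
  note charts = atlas_is_chart[OF A c(1)] atlas_is_chart[OF A c(2)]
  have mem: "coords c p \<in> ?S"
    using p by blast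
  have "smooth_on ?S (coords c' \<circ> param c)"
    using A c by (simp add: smooth_atlas_def)
  then have "Ck_on (Suc 0) ?S (coords c' \<circ> param c)"
    by (simp only: smooth_on_def)
  note this[THEN Ck_on_Suc_has_derivative, OF mem]
  moreover have "open ?S"
  proof -
    have "openin (top_of_set (dom_chart c)) (dom_chart c \<inter> dom_chart c')"
      using charts by (simp add: is_chart_def openin_open_Int)
    then have "openin (top_of_set (img_chart c)) ?S"
      using charts homeomorphism_imp_open_map unfolding is_chart_def by blast
    then show ?thesis
      using open_img_chart[OF charts(1)] openin_open_trans by blast
  qed
  then have "at (coords c p) within ?S = at (coords c p)"
    using mem by (intro at_within_open)
  ultimately show ?thesis
    by (simp add: jac_def chart_deriv_frechet comp_def)
qed

lemma cov_deriv_const [simp]: "cov_deriv \<Gamma> c (\<lambda>_. v) p u = \<Gamma> c p u v"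
  by (simp add: cov_deriv_def)

lemma levi_civita_symmetric:
  assumes "levi_civita A g \<Gamma>" "c \<in> A" "is_chart c" "p \<in> dom_chart c"
  shows "\<Gamma> c p u v = \<Gamma> c p v u"
proof -
  have "cov_deriv \<Gamma> c (\<lambda>_. v) p u - cov_deriv \<Gamma> c (\<lambda>_. u) p v = lie_bracket c (\<lambda>_. u) (\<lambda>_. v) p"
    using assms smooth_in_chart_const[OF assms(3)] unfolding levi_civita_def by blast
  then show ?thesis
    by (simp add: lie_bracket_def)
qed

lemma levi_civita_metric:
  assumes "levi_civita A g \<Gamma>" "c \<in> A" "is_chart c" "p \<in> dom_chart c"
    and "smooth_in_chart c Y" "smooth_in_chart c Z"
  shows "chart_deriv c (\<lambda>q. g c q (Y q) (Z q)) p u =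
    g c p (cov_deriv \<Gamma> c Y p u) (Z p) + g c p (Y p) (cov_deriv \<Gamma> c Z p u)"
  using assms(1)[unfolded levi_civita_def, THEN conjunct2, THEN conjunct2, rule_format,
      where X = "\<lambda>_. u", OF assms(2) _ assms(4)] smooth_in_chart_const[OF assms(3)] assms(5,6)
  by blast

section \<open>Sasaki-like geometry at a point\<close>

locale sasaki_chart =
  fixes A :: "'m::{t2_space,second_countable_topology} chart set"
    and \<phi> :: "'m endo_field" and \<xi> :: "'m vec_field" and \<eta> :: "'m form_field"
    and g :: "'m bilin_field" and \<Gamma> :: "'m conn" and c :: "'m chart"
  assumes M: "sasaki_like A \<phi> \<xi> \<eta> g \<Gamma>" and c: "c \<in> A"
begin

lemma sasaki_structure:
  shows almost_contact: "almost_contact_B_metric A \<phi> \<xi> \<eta> g" and LC: "levi_civita A g \<Gamma>"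
    and atlas: "smooth_atlas A"
  using M by (auto simp: sasaki_like_def almost_contact_B_metric_def)

lemma chart: "is_chart c"
  using atlas c by (auto simp: smooth_atlas_def)

lemma smooth_tensors:
  shows smooth_phi: "smooth_in_chart c (\<lambda>q. \<phi> c q v)" and smooth_xi: "smooth_in_chart c (\<xi> c)"
    and smooth_eta: "smooth_in_chart c (\<lambda>q. \<eta> c q v)"
    and smooth_g: "smooth_in_chart c (\<lambda>q. g c q v w)"
  using almost_contact c
  by (auto simp: almost_contact_B_metric_def endomorphism_field_def vector_field_def one_form_def
      pseudo_riemannian_metric_def)

lemma tangent_space:
  assumes "p \<in> dom_chart c"
  shows "contact_B_space (\<phi> c p) (\<xi> c p) (\<eta> c p) (g c p)"
proof -
  have "linear (\<phi> c p)" "linear (\<eta> c p)"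
    using almost_contact c assms
    by (auto simp: almost_contact_B_metric_def endomorphism_field_def one_form_def)
  moreover have "bilinear (g c p) \<and> (\<forall>v w. g c p v w = g c p w v) \<and> (\<forall>v. (\<forall>w. g c p v w = 0) \<longrightarrow> v = 0)"
    using almost_contact c assms
    unfolding almost_contact_B_metric_def pseudo_riemannian_metric_def by blast
  moreover have "(\<forall>u. \<phi> c p (\<phi> c p u) = - u + \<eta> c p u *\<^sub>R \<xi> c p) \<and> \<eta> c p (\<xi> c p) = 1 \<and>
      (\<forall>u v. g c p (\<phi> c p u) (\<phi> c p v) = - g c p u v + \<eta> c p u * \<eta> c p v)"
    using almost_contact c assms unfolding almost_contact_B_metric_def by blast
  ultimately show ?thesis
    by (intro contact_B_space.intro; blast)
qed

lemma bilinear_conn: "p \<in> dom_chart c \<Longrightarrow> bilinear (\<Gamma> c p)"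
  using LC c by (auto simp: levi_civita_def affine_connection_def)

lemma nabla_phi:
  assumes "p \<in> dom_chart c" "smooth_in_chart c Y"
  shows "cov_deriv \<Gamma> c (\<lambda>q. \<phi> c q (Y q)) p u = \<phi> c p (cov_deriv \<Gamma> c Y p u)
    - g c p u (Y p) *\<^sub>R \<xi> c p - \<eta> c p (Y p) *\<^sub>R u + (2 * \<eta> c p u * \<eta> c p (Y p)) *\<^sub>R \<xi> c p"
proof -
  have smooth: "smooth_in_chart c (\<lambda>_. u) \<and> smooth_in_chart c Y"
    using smooth_in_chart_const[OF chart] assms(2) by simp
  have "cov_deriv \<Gamma> c (\<lambda>q. \<phi> c q (Y q)) p u - \<phi> c p (cov_deriv \<Gamma> c Y p u) =
      - g c p u (Y p) *\<^sub>R \<xi> c p - \<eta> c p (Y p) *\<^sub>R u + (2 * \<eta> c p u * \<eta> c p (Y p)) *\<^sub>R \<xi> c p"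
    by (rule M[unfolded sasaki_like_def, THEN conjunct2, THEN conjunct2, rule_format,
          where X = "\<lambda>_. u" and Y = Y, OF c smooth assms(1)])
  moreover have "x = y - r *\<^sub>R z - v + w" if "x - y = - r *\<^sub>R z - v + w" for r and x y z v w :: "real^3"
    using that by (simp add: algebra_simps)
  ultimately show ?thesis
    by blast
qed

text \<open>Differentiating \<open>\<phi> \<xi> = 0\<close> determines \<open>\<nabla>\<^sub>u \<xi>\<close> up to a multiple of \<open>\<xi>\<close>, and
  differentiating \<open>g(\<xi>, \<xi>) = 1\<close> determines that multiple.\<close>

lemma nabla_xi:
  assumes p: "p \<in> dom_chart c"
  shows "cov_deriv \<Gamma> c (\<xi> c) p u = - \<phi> c p u"
proof -
  interpret T: contact_B_space "\<phi> c p" "\<xi> c p" "\<eta> c p" "g c p"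
    using p by (rule tangent_space)
  have "chart_deriv c (\<lambda>q. \<phi> c q (\<xi> c q)) p u = chart_deriv c (\<lambda>_. 0) p u"
    by (subst chart_deriv_cong[OF chart p, of _ "\<lambda>_. 0"])
      (use contact_B_space.phi_xi[OF tangent_space] in auto)
  then have "cov_deriv \<Gamma> c (\<lambda>q. \<phi> c q (\<xi> c q)) p u = 0"
    using bilinear_rzero[OF bilinear_conn[OF p]] by (simp add: cov_deriv_def T.phi_xi)
  then have zero: "\<phi> c p (cov_deriv \<Gamma> c (\<xi> c) p u) - \<eta> c p u *\<^sub>R \<xi> c p - u + (2 * \<eta> c p u) *\<^sub>R \<xi> c p = 0"
    by (simp add: nabla_phi[OF p smooth_xi] T.metric_xi T.eta_xi)
  have double: "(2 * \<eta> c p u) *\<^sub>R \<xi> c p = \<eta> c p u *\<^sub>R \<xi> c p + \<eta> c p u *\<^sub>R \<xi> c p"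
    by (simp only: mult_2 scaleR_add_left)
  have solve: "x = - y + z" if "x - y - z + (y + y) = 0" for x y z :: "real^3"
  proof -
    have "x $ i = (- y + z) $ i" for i
      using arg_cong[OF that, of "\<lambda>v. v $ i"] by simp
    then show ?thesis
      unfolding vec_eq_iff by blast
  qed
  from arg_cong[OF solve[OF zero[unfolded double]], of "\<phi> c p"]
  have 1: "\<phi> c p (\<phi> c p (cov_deriv \<Gamma> c (\<xi> c) p u)) = \<phi> c p u"
    by (simp add: T.phi_simps T.phi_xi)
  have "chart_deriv c (\<lambda>q. g c q (\<xi> c q) (\<xi> c q)) p u = chart_deriv c (\<lambda>_. 1) p u"
    by (subst chart_deriv_cong[OF chart p, of _ "\<lambda>_. 1"])
      (use contact_B_space.metric_xi[OF tangent_space] contact_B_space.eta_xi[OF tangent_space] in auto)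
  then have "\<eta> c p (cov_deriv \<Gamma> c (\<xi> c) p u) = 0"
    by (simp add: levi_civita_metric[OF LC c chart p smooth_xi smooth_xi] T.metric_xi)
  with 1 show ?thesis
    by (simp add: T.phi_phi[of "cov_deriv \<Gamma> c (\<xi> c) p u"] minus_equation_iff)
qed

text \<open>Equivalently, \<open>(\<nabla>\<^sub>u \<eta>) v = - g(v, \<phi> u)\<close>, obtained from \<open>\<eta> = g(\<cdot>, \<xi>)\<close>.\<close>

lemma deriv_eta:
  assumes p: "p \<in> dom_chart c"
  shows "chart_deriv c (\<lambda>q. \<eta> c q v) p u = \<eta> c p (\<Gamma> c p u v) - g c p v (\<phi> c p u)"
proof -
  interpret T: contact_B_space "\<phi> c p" "\<xi> c p" "\<eta> c p" "g c p"
    using p by (rule tangent_space)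
  have "chart_deriv c (\<lambda>q. \<eta> c q v) p = chart_deriv c (\<lambda>q. g c q v (\<xi> c q)) p"
    by (rule chart_deriv_cong[OF chart p]) (simp add: contact_B_space.metric_xi[OF tangent_space])
  then show ?thesis
    by (simp add: levi_civita_metric[OF LC c chart p smooth_in_chart_const[OF chart] smooth_xi]
        nabla_xi[OF p] T.metric_xi T.metric_simps)
qed

text \<open>The associated metric need not be parallel for \<open>\<nabla>\<close>. The defect comes from the derivatives of
  \<open>\<phi>\<close> and \<open>\<eta>\<close>, and it has exactly the shape that a multiple of \<open>\<xi>\<close> added to the connection can
  compensate.\<close>

lemma deriv_associated:
  assumes p: "p \<in> dom_chart c"
  shows "chart_deriv c (\<lambda>q. associated_metric \<phi> \<eta> g c q v w) p u =
    associated_metric \<phi> \<eta> g c p (\<Gamma> c p u v) w + associated_metric \<phi> \<eta> g c p v (\<Gamma> c p u w)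
    - \<eta> c p v * (g c p u (\<phi> c p w) - g c p (\<phi> c p u) (\<phi> c p w))
    - \<eta> c p w * (g c p u (\<phi> c p v) - g c p (\<phi> c p u) (\<phi> c p v))"
proof -
  interpret T: contact_B_space "\<phi> c p" "\<xi> c p" "\<eta> c p" "g c p"
    using p by (rule tangent_space)
  have "smooth_in_chart c (\<lambda>q. g c q v (\<phi> c q w))"
    by (rule smooth_in_chart_linear_family[OF chart])
      (use contact_B_space.bilinear_metric[OF tangent_space] in
        \<open>auto simp: bilinear_def smooth_g smooth_phi\<close>)
  from chart_has_derivative[OF chart this p] chart_has_derivative[OF chart smooth_eta p, of v]
    chart_has_derivative[OF chart smooth_eta p, of w]
  have "chart_deriv c (\<lambda>q. associated_metric \<phi> \<eta> g c q v w) p =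
      (\<lambda>u. chart_deriv c (\<lambda>q. g c q v (\<phi> c q w)) p u +
        (\<eta> c p v * chart_deriv c (\<lambda>q. \<eta> c q w) p u + chart_deriv c (\<lambda>q. \<eta> c q v) p u * \<eta> c p w))"
    unfolding associated_metric_def
    by (intro chart_deriv_eq has_derivative_add)
      (auto intro!: has_derivative_eq_rhs[OF has_derivative_mult] simp: param_coords[OF chart p])
  moreover have "chart_deriv c (\<lambda>q. g c q v (\<phi> c q w)) p u =
      g c p (\<Gamma> c p u v) (\<phi> c p w) + g c p v (cov_deriv \<Gamma> c (\<lambda>q. \<phi> c q w) p u)"
    using levi_civita_metric[OF LC c chart p smooth_in_chart_const[OF chart] smooth_phi] by simp
  moreover have "g c p w (\<phi> c p u) = g c p u (\<phi> c p w)" "g c p v (\<phi> c p u) = g c p u (\<phi> c p v)"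
    "g c p v u = g c p u v"
    using T.metric_phi_swap T.metric_sym by metis+
  ultimately show ?thesis
    unfolding associated_metric_def
    by (simp add: nabla_phi[OF p smooth_in_chart_const[OF chart]] deriv_eta[OF p] T.metric_simps T.metric_xi
        T.metric_phi_phi algebra_simps)
qed

text \<open>Uniqueness of the Levi-Civita connection: the difference of the two sides is symmetric in
  \<open>u, v\<close> and skew with respect to the associated metric, hence zero.\<close>

lemma associated_connection:
  assumes LCt: "levi_civita A (associated_metric \<phi> \<eta> g) \<Gamma>t" and p: "p \<in> dom_chart c"
  shows "\<Gamma>t c p u v = \<Gamma> c p u v - (g c p u (\<phi> c p v) - g c p (\<phi> c p u) (\<phi> c p v)) *\<^sub>R \<xi> c p"
proof -
  interpret T: contact_B_space "\<phi> c p" "\<xi> c p" "\<eta> c p" "g c p"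
    using p by (rule tangent_space)
  define S where "S u v = g c p u (\<phi> c p v) - g c p (\<phi> c p u) (\<phi> c p v)" for u v
  define R where "R u v = \<Gamma>t c p u v - \<Gamma> c p u v + S u v *\<^sub>R \<xi> c p" for u v
  let ?h = "associated_metric \<phi> \<eta> g c p"
  have "S u v = S v u" for u v
    using T.metric_phi_swap[of u v] T.metric_sym by (simp add: S_def)
  then have sym: "R u v = R v u" for u v
    using levi_civita_symmetric[OF LCt c chart p, of u v]
      levi_civita_symmetric[OF LC c chart p, of u v] by (simp add: R_def)
  have skew: "?h (R u v) w = - ?h (R u w) v" for u v w
  proof -
    have "chart_deriv c (\<lambda>q. associated_metric \<phi> \<eta> g c q v w) p u =
        ?h (\<Gamma>t c p u v) w + ?h v (\<Gamma>t c p u w)"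
      using levi_civita_metric[OF LCt c chart p smooth_in_chart_const[OF chart]
          smooth_in_chart_const[OF chart]] by simp
    moreover have "?h v (\<Gamma> c p u w) = ?h (\<Gamma> c p u w) v" "?h v (\<Gamma>t c p u w) = ?h (\<Gamma>t c p u w) v"
      by (simp_all add: associated_metric_def T.metric_sym[of v] T.metric_phi_swap)
    moreover have R: "?h (R u v) w = ?h (\<Gamma>t c p u v) w - ?h (\<Gamma> c p u v) w + \<eta> c p w * S u v" for v w
      by (simp add: R_def associated_metric_def T.metric_simps T.eta_simps T.metric_xi T.eta_phi T.eta_xi algebra_simps)
    ultimately show ?thesis
      using deriv_associated[OF p, of v w u, folded S_def] R[of v w] R[of w v] by linarith
  qed
  \<comment> \<open>Alternating the symmetry in \<open>u, v\<close> with the skewness in \<open>v, w\<close> six times permutes the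
    arguments back to their order, with three changes of sign.\<close>
  have "?h (R u v) w = 0" for w
    using skew[of u v w] skew[of w u v] skew[of v w u] sym[of u v] sym[of u w] sym[of v w] by simp
  then have "R u v = 0"
    by (intro T.associated_nondeg) (simp add: associated_metric_def)
  then show ?thesis
    by (simp add: R_def S_def algebra_simps)
qed

end

section \<open>Differentiation along a curve\<close>

lemma interval_at_neq_bot:
  fixes I :: "real set"
  assumes "is_interval I" "p \<in> I" "q \<in> I" "p < q" "t \<in> I"
  shows "at t within I \<noteq> bot"
proof -
  have "solid I"
    using solid_interval_Int_open[OF assms(1-4) open_UNIV] by simp
  then have "\<exists>x\<in>I. x \<noteq> t \<and> dist x t < e" if "e > 0" for e
    using that assms(5) by (force simp: solid_def dist_real_def)
  then show ?thesis
    by (simp add: trivial_limit_within islimpt_approachable)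
qed

locale chart_curve =
  fixes A :: "'m::{t2_space,second_countable_topology} chart set"
    and I :: "real set" and C :: "real \<Rightarrow> 'm" and c :: "'m chart"
  assumes curve: "smooth_curve A I C" and chart_atlas: "smooth_atlas A" "c \<in> A"
begin

text \<open>The derivative in \<open>velocity\<close> is taken within \<open>I\<close>, whereas smoothness of the curve is given
  within the times spent in the chart. These form a relatively open subset of \<open>I\<close>, so that both
  notions of derivative agree there.\<close>

definition "chart_times = {t \<in> I. C t \<in> dom_chart c}"

lemma is_chart: "is_chart c"
  using chart_atlas by (auto simp: smooth_atlas_def)

lemma times_open: obtains U where "open U" "chart_times = I \<inter> U"
proof -
  have "continuous_on I C" "open (dom_chart c)"
    using curve is_chart by (auto simp: smooth_curve_def is_chart_def)
  then obtain U where "open U" "U \<inter> I = C -` dom_chart c \<inter> I"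
    by (meson continuous_on_open_invariant)
  then show thesis
    using that[of U] by (auto simp: chart_times_def)
qed

lemma solid_times: "solid chart_times"
proof -
  obtain U where "open U" "chart_times = I \<inter> U"
    using times_open .
  moreover obtain p q where "is_interval I" "p \<in> I" "q \<in> I" "p < q"
    using curve by (auto simp: smooth_curve_def)
  ultimately show ?thesis
    using solid_interval_Int_open by metis
qed

lemma at_times: "t \<in> chart_times \<Longrightarrow> at t within chart_times = at t within I"
proof -
  assume t: "t \<in> chart_times"
  obtain U where U: "open U" "chart_times = I \<inter> U"
    using times_open .
  then show ?thesis
    using t by (intro at_within_nhd[of t U]) auto
qed

lemma at_neq_bot: "t \<in> chart_times \<Longrightarrow> at t within I \<noteq> bot"
  using interval_at_neq_bot curve by (auto simp: smooth_curve_def chart_times_def)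

lemma deriv_cong:
  assumes "t \<in> chart_times" "\<And>r. r \<in> chart_times \<Longrightarrow> F r = F' r"
  shows "(F has_vector_derivative D) (at t within I) \<longleftrightarrow> (F' has_vector_derivative D) (at t within I)"
  using assms(1,2) unfolding at_times[OF assms(1), symmetric] has_vector_derivative_def
  by (intro iffI; elim has_derivative_transform[rotated 2]) auto

lemma vector_derivative_cong_times:
  assumes "t \<in> chart_times" "\<And>r. r \<in> chart_times \<Longrightarrow> F r = F' r"
  shows "vector_derivative F (at t within I) = vector_derivative F' (at t within I)"
  by (simp add: vector_derivative_def deriv_cong[OF assms(1), of F F'] assms(2))

lemma vector_derivative_times:
  "t \<in> chart_times \<Longrightarrow> (F has_vector_derivative D) (at t within I) \<Longrightarrow>
    vector_derivative F (at t within I) = D"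
  using at_neq_bot by (rule vector_derivative_within)

lemma smooth_has_vector_derivative:
  assumes "smooth_on chart_times F" "t \<in> chart_times"
  shows "(F has_vector_derivative vector_derivative F (at t within I)) (at t within I)"
proof -
  have "Ck_on (Suc 0) chart_times F"
    using assms(1) by (simp only: smooth_on_def)
  then have "F differentiable (at t within I)"
    using assms(2) at_times by auto
  then show ?thesis
    by (simp add: vector_derivative_works)
qed

lemma smooth_vector_derivative:
  assumes "smooth_on chart_times F"
  shows "smooth_on chart_times (\<lambda>t. vector_derivative F (at t within I))"
  unfolding smooth_on_def
proof
  fix k
  have F: "Ck_on (Suc k) chart_times F"
    using assms by (simp only: smooth_on_def)
  then have d: "Ck_on k chart_times (\<lambda>t. frechet_derivative F (at t within chart_times) 1)"
    by simp
  have eq: "frechet_derivative F (at t within chart_times) 1 = vector_derivative F (at t within I)"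
    if "t \<in> chart_times" for t
    using solid_has_derivative_unique[OF solid_times that, of F]
      smooth_has_vector_derivative[OF assms that]
    by (simp add: at_times[OF that] has_vector_derivative_def)
  show "Ck_on k chart_times (\<lambda>t. vector_derivative F (at t within I))"
    by (rule Ck_on_cong[THEN iffD1, OF eq d])
qed

lemma smooth_coords: "smooth_on chart_times (coords c \<circ> C)"
  using curve chart_atlas by (simp add: smooth_curve_def chart_times_def)

lemma smooth_velocity: "smooth_on chart_times (velocity I C c)"
  using smooth_vector_derivative[OF smooth_coords] by (simp add: velocity_def[abs_def])

lemma has_velocity:
  "t \<in> chart_times \<Longrightarrow> ((coords c \<circ> C) has_vector_derivative velocity I C c t) (at t within I)"
  unfolding velocity_def by (rule smooth_has_vector_derivative[OF smooth_coords])

lemma smooth_along: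
  assumes "smooth_in_chart c f"
  shows "smooth_on chart_times (\<lambda>t. f (C t))"
  unfolding smooth_on_def
proof
  fix k
  have "Ck_on k chart_times (\<lambda>t. f (param c ((coords c \<circ> C) t)))"
  proof (rule Ck_on_compose[OF solid_times])
    show "Ck_on k chart_times (coords c \<circ> C)"
      using smooth_coords by (simp only: smooth_on_def)
    show "Ck_on k (img_chart c) (\<lambda>x. f (param c x))"
      using assms by (simp only: smooth_in_chart_def smooth_on_def)
  qed (auto simp: chart_times_def coords_in_img)
  then show "Ck_on k chart_times (\<lambda>t. f (C t))"
    by (rule Ck_on_cong[THEN iffD1, rotated]) (simp add: chart_times_def param_coords[OF is_chart])
qed

lemma deriv_along:
  assumes t: "t \<in> chart_times" and "smooth_in_chart c f"
  shows "((\<lambda>t. f (C t)) has_vector_derivative chart_deriv c f (C t) (velocity I C c t))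
    (at t within I)"
proof -
  have "C t \<in> dom_chart c"
    using t by (simp add: chart_times_def)
  from has_derivative_compose[OF has_velocity[OF t, unfolded has_vector_derivative_def],
      unfolded comp_def, OF chart_has_derivative[OF is_chart assms(2) this]]
  have "((\<lambda>t. f (param c (coords c (C t)))) has_vector_derivative
      chart_deriv c f (C t) (velocity I C c t)) (at t within I)"
    using linear_scale[OF chart_deriv_linear[OF is_chart assms(2) \<open>C t \<in> dom_chart c\<close>]]
    by (simp add: has_vector_derivative_def)
  then show ?thesis
    by (rule deriv_cong[OF t, THEN iffD1, rotated])
      (simp add: chart_times_def param_coords[OF is_chart])
qed

lemma smooth_linear_along:
  fixes F :: "real \<Rightarrow> real^3"
  assumes "\<And>q. q \<in> dom_chart c \<Longrightarrow> linear (B q)" "\<And>v. smooth_in_chart c (\<lambda>q. B q v)"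
    and "smooth_on chart_times F"
  shows "smooth_on chart_times (\<lambda>t. B (C t) (F t))"
  unfolding smooth_on_def
proof
  fix k
  show "Ck_on k chart_times (\<lambda>t. B (C t) (F t))"
  proof (rule Ck_on_linear_family[OF solid_times])
    show "Ck_on k chart_times (\<lambda>t. B (C t) v)" for v
      using smooth_along[OF assms(2)] by (simp only: smooth_on_def)
    show "Ck_on k chart_times F"
      using assms(3) by (simp only: smooth_on_def)
  qed (auto simp: chart_times_def assms(1))
qed

text \<open>The Leibniz rule for a tensor field evaluated on a vector field along the curve, obtained
  by expanding the vector field in the coordinate basis.\<close>

lemma deriv_linear_along:
  fixes F :: "real \<Rightarrow> real^3"
  assumes t: "t \<in> chart_times"
    and B: "\<And>q. q \<in> dom_chart c \<Longrightarrow> linear (B q)" "\<And>v. smooth_in_chart c (\<lambda>q. B q v)"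
    and F: "(F has_vector_derivative F') (at t within I)"
  shows "((\<lambda>t. B (C t) (F t)) has_vector_derivative
    chart_deriv c (\<lambda>q. B q (F t)) (C t) (velocity I C c t) + B (C t) F') (at t within I)"
proof -
  have Ct: "C t \<in> dom_chart c"
    using t by (simp add: chart_times_def)
  let ?d = "\<lambda>v. chart_deriv c (\<lambda>q. B q v) (C t)"
  have F_i: "((\<lambda>t. F t \<bullet> i) has_real_derivative F' \<bullet> i) (at t within I)" for i
    using bounded_linear.has_vector_derivative[OF bounded_linear_inner_left F]
    by (simp add: has_real_derivative_iff_has_vector_derivative)
  have d: "?d (F t) = (\<lambda>u. \<Sum>i\<in>Basis. (F t \<bullet> i) *\<^sub>R ?d i u)"
  proof (rule trans[OF chart_deriv_cong[OF is_chart Ct] chart_deriv_eq])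
    show "B q (F t) = (\<Sum>i\<in>Basis. (F t \<bullet> i) *\<^sub>R B q i)" if "q \<in> dom_chart c" for q
      using that by (intro linear_basis_expansion B)
  qed (intro has_derivative_sum has_derivative_scaleR_right chart_has_derivative is_chart B Ct)
  have "((\<lambda>t. \<Sum>i\<in>Basis. (F t \<bullet> i) *\<^sub>R B (C t) i) has_vector_derivative
      (\<Sum>i\<in>Basis. (F t \<bullet> i) *\<^sub>R ?d i (velocity I C c t) + (F' \<bullet> i) *\<^sub>R B (C t) i)) (at t within I)"
    by (intro has_vector_derivative_sum has_vector_derivative_scaleR F_i deriv_along t B)
  also have "(\<Sum>i\<in>Basis. (F t \<bullet> i) *\<^sub>R ?d i (velocity I C c t) + (F' \<bullet> i) *\<^sub>R B (C t) i) =
      ?d (F t) (velocity I C c t) + B (C t) F'"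
    by (simp add: sum.distrib d linear_basis_expansion[OF B(1)[OF Ct], symmetric])
  finally show ?thesis
    by (rule deriv_cong[OF t, THEN iffD1, rotated])
      (auto simp: chart_times_def linear_basis_expansion[OF B(1), symmetric])
qed

lemma velocity_jac:
  assumes t: "t \<in> chart_times" and "c' \<in> A" "C t \<in> dom_chart c'"
  shows "velocity I C c' t = jac c c' (C t) (velocity I C c t)"
proof -
  have Ct: "C t \<in> dom_chart c"
    using t by (simp add: chart_times_def)
  note J = jac_has_derivative[OF chart_atlas(1,2) assms(2) Ct assms(3)]
  have "((\<lambda>t. coords c' (param c (coords c (C t)))) has_vector_derivative
      jac c c' (C t) (velocity I C c t)) (at t within I)"
    using has_derivative_compose[OF has_velocity[OF t, unfolded has_vector_derivative_def],
        unfolded comp_def, OF J] linear_scale[OF has_derivative_linear[OF J]]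
    by (simp add: has_vector_derivative_def)
  then have "((coords c' \<circ> C) has_vector_derivative jac c c' (C t) (velocity I C c t)) (at t within I)"
    by (rule deriv_cong[OF t, THEN iffD1, rotated]) (simp add: chart_times_def param_coords[OF is_chart])
  then show ?thesis
    unfolding velocity_def using t by (intro vector_derivative_times)
qed

end

locale sasaki_curve = sasaki_chart A \<phi> \<xi> \<eta> g \<Gamma> c
  for A :: "'m::{t2_space,second_countable_topology} chart set"
    and \<phi> \<xi> \<eta> g \<Gamma> c +
  fixes I :: "real set" and C :: "real \<Rightarrow> 'm"
  assumes smooth_curve: "smooth_curve A I C"
begin

sublocale chart_curve A I C c
  by unfold_locales (use smooth_curve atlas c in auto)

abbreviation "V \<equiv> velocity I C c"

lemma tangent: "t \<in> chart_times \<Longrightarrow> contact_B_space (\<phi> c (C t)) (\<xi> c (C t)) (\<eta> c (C t)) (g c (C t))"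
  by (rule tangent_space) (simp add: chart_times_def)

text \<open>In the following rules the derivative of a vector field \<open>Y\<close> along the curve is written as
  \<open>D - \<Gamma>(V, Y)\<close>, so that \<open>D\<close> is its covariant derivative.\<close>

lemma xi_along:
  assumes t: "t \<in> chart_times"
  shows "((\<lambda>t. \<xi> c (C t)) has_vector_derivative
    - \<phi> c (C t) (V t) - \<Gamma> c (C t) (V t) (\<xi> c (C t))) (at t within I)"
  using deriv_along[OF t smooth_xi] nabla_xi[of "C t" "V t"] t
  by (simp add: cov_deriv_def chart_times_def eq_diff_eq[symmetric])

lemma phi_along:
  assumes t: "t \<in> chart_times" and Y: "(Y has_vector_derivative D - \<Gamma> c (C t) (V t) (Y t)) (at t within I)"
  shows "((\<lambda>t. \<phi> c (C t) (Y t)) has_vector_derivative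
    \<phi> c (C t) D - g c (C t) (V t) (Y t) *\<^sub>R \<xi> c (C t) - \<eta> c (C t) (Y t) *\<^sub>R V t
    + (2 * \<eta> c (C t) (V t) * \<eta> c (C t) (Y t)) *\<^sub>R \<xi> c (C t)
    - \<Gamma> c (C t) (V t) (\<phi> c (C t) (Y t))) (at t within I)"
proof -
  interpret T: contact_B_space "\<phi> c (C t)" "\<xi> c (C t)" "\<eta> c (C t)" "g c (C t)"
    using t by (rule tangent)
  have Ct: "C t \<in> dom_chart c"
    using t by (simp add: chart_times_def)
  note d = deriv_linear_along[OF t contact_B_space.linear_phi[OF tangent_space] smooth_phi Y]
  show ?thesis
    using nabla_phi[OF Ct smooth_in_chart_const[OF chart], of "Y t" "V t"]
    by (intro has_vector_derivative_eq_rhs[OF d]) (simp_all add: cov_deriv_def T.phi_simps algebra_simps)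
qed

lemma eta_along:
  assumes t: "t \<in> chart_times" and Y: "(Y has_vector_derivative D - \<Gamma> c (C t) (V t) (Y t)) (at t within I)"
  shows "((\<lambda>t. \<eta> c (C t) (Y t)) has_vector_derivative
    \<eta> c (C t) D - g c (C t) (Y t) (\<phi> c (C t) (V t))) (at t within I)"
proof -
  interpret T: contact_B_space "\<phi> c (C t)" "\<xi> c (C t)" "\<eta> c (C t)" "g c (C t)"
    using t by (rule tangent)
  have Ct: "C t \<in> dom_chart c"
    using t by (simp add: chart_times_def)
  note d = deriv_linear_along[OF t contact_B_space.linear_eta[OF tangent_space] smooth_eta Y]
  show ?thesis
    by (rule has_vector_derivative_eq_rhs[OF d]) (simp_all add: deriv_eta[OF Ct] T.eta_simps)
qed

text \<open>The metric is differentiated in one argument by \<open>deriv_linear_along\<close>; expanding the other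
  argument in the basis then gives the Leibniz rule in both.\<close>

lemma metric_along:
  assumes t: "t \<in> chart_times"
    and Y: "(Y has_vector_derivative D - \<Gamma> c (C t) (V t) (Y t)) (at t within I)"
    and Z: "(Z has_vector_derivative E - \<Gamma> c (C t) (V t) (Z t)) (at t within I)"
  shows "((\<lambda>t. g c (C t) (Y t) (Z t)) has_vector_derivative
    g c (C t) D (Z t) + g c (C t) (Y t) E) (at t within I)"
proof -
  interpret T: contact_B_space "\<phi> c (C t)" "\<xi> c (C t)" "\<eta> c (C t)" "g c (C t)"
    using t by (rule tangent)
  have Ct: "C t \<in> dom_chart c"
    using t by (simp add: chart_times_def)
  have lin: "linear (g c q v)" "linear (\<lambda>v. g c q v w)" if "q \<in> dom_chart c" for q v w
    using contact_B_space.bilinear_metric[OF tangent_space[OF that]] by (auto simp: bilinear_def)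
  let ?Y' = "D - \<Gamma> c (C t) (V t) (Y t)"
  have Y_i: "((\<lambda>t. Y t \<bullet> i) has_real_derivative ?Y' \<bullet> i) (at t within I)" for i
    using bounded_linear.has_vector_derivative[OF bounded_linear_inner_left Y]
    by (simp add: has_real_derivative_iff_has_vector_derivative)
  have Z_i: "((\<lambda>t. g c (C t) i (Z t)) has_vector_derivative
      g c (C t) (\<Gamma> c (C t) (V t) i) (Z t) + g c (C t) i E) (at t within I)" for i
  proof -
    have "chart_deriv c (\<lambda>q. g c q i (Z t)) (C t) (V t) =
        g c (C t) (\<Gamma> c (C t) (V t) i) (Z t) + g c (C t) i (\<Gamma> c (C t) (V t) (Z t))"
      using levi_civita_metric[OF LC c chart Ct smooth_in_chart_const[OF chart]
          smooth_in_chart_const[OF chart]] by simp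
    then show ?thesis
      by (intro has_vector_derivative_eq_rhs[OF
            deriv_linear_along[OF t lin(1)[where v = i] smooth_g[where v = i] Z]])
        (simp_all add: T.metric_simps)
  qed
  have L: "linear (\<lambda>v. g c (C t) (\<Gamma> c (C t) (V t) v) (Z t) + g c (C t) v E)"
    using bilinear_conn[OF Ct]
    by (intro linear_compose_add lin(2)[OF Ct] linear_compose[unfolded comp_def, OF _ lin(2)[OF Ct]])
      (simp add: bilinear_def)
  have "((\<lambda>t. \<Sum>i\<in>Basis. (Y t \<bullet> i) *\<^sub>R g c (C t) i (Z t)) has_vector_derivative
      (\<Sum>i\<in>Basis. (Y t \<bullet> i) *\<^sub>R (g c (C t) (\<Gamma> c (C t) (V t) i) (Z t) + g c (C t) i E)
        + (?Y' \<bullet> i) *\<^sub>R g c (C t) i (Z t))) (at t within I)"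
    by (intro has_vector_derivative_sum has_vector_derivative_scaleR Y_i Z_i)
  also have "(\<Sum>i\<in>Basis. (Y t \<bullet> i) *\<^sub>R (g c (C t) (\<Gamma> c (C t) (V t) i) (Z t) + g c (C t) i E)
        + (?Y' \<bullet> i) *\<^sub>R g c (C t) i (Z t)) =
      g c (C t) (\<Gamma> c (C t) (V t) (Y t)) (Z t) + g c (C t) (Y t) E + g c (C t) ?Y' (Z t)"
    unfolding sum.distrib linear_basis_expansion[OF L, symmetric]
      linear_basis_expansion[OF lin(2)[OF Ct], symmetric] ..
  also have "\<dots> = g c (C t) D (Z t) + g c (C t) (Y t) E"
    by (simp add: T.metric_simps)
  finally show ?thesis
    by (rule deriv_cong[OF t, THEN iffD1, rotated])
      (rule linear_basis_expansion[OF lin(2), symmetric], simp add: chart_times_def)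
qed

lemma deriv_const_along:
  assumes "t \<in> chart_times" "(F has_vector_derivative D) (at t within I)"
    and "\<And>r. r \<in> chart_times \<Longrightarrow> F r = k"
  shows "D = 0"
proof -
  have "(F has_vector_derivative 0) (at t within I)"
    by (rule deriv_cong[OF assms(1), THEN iffD2, of _ "\<lambda>_. k"]) (auto simp: assms(3))
  then show ?thesis
    using assms vector_derivative_times by metis
qed

end

section \<open>Affine reparametrization\<close>

text \<open>The inverse of the affine parameter change maps \<open>J\<close> onto \<open>I\<close>, and both claims follow by composing
  \<open>C\<close> with it.\<close>

lemma affine_reparametrization:
  fixes C \<gamma> :: "real \<Rightarrow> 'm::{t2_space,second_countable_topology}"
  assumes A: "smooth_atlas A" and C: "smooth_curve A I C" and k: "k > 0"
    and J: "J = (\<lambda>t. k * (t - t0)) ` I" and \<gamma>: "\<And>t. t \<in> I \<Longrightarrow> \<gamma> (k * (t - t0)) = C t"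
  shows "smooth_curve A J \<gamma>"
    and "\<And>t c. t \<in> I \<Longrightarrow> c \<in> A \<Longrightarrow> C t \<in> dom_chart c \<Longrightarrow>
      velocity J \<gamma> c (k * (t - t0)) = (1 / k) *\<^sub>R velocity I C c t"
proof -
  define \<iota> where "\<iota> \<sigma> = t0 + (1 / k) *\<^sub>R \<sigma>" for \<sigma>
  have inv: "\<iota> (k * (t - t0)) = t" for t
    using k by (simp add: \<iota>_def)
  have \<iota>_J: "\<iota> ` J = I"
    by (simp add: J image_image inv)
  have \<gamma>_\<iota>: "\<gamma> \<sigma> = C (\<iota> \<sigma>)" if "\<sigma> \<in> J" for \<sigma>
    using that \<gamma> inv by (auto simp: J)
  obtain p q where I: "is_interval I" "p \<in> I" "q \<in> I" "p < q"
    using C by (auto simp: smooth_curve_def)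
  have "is_interval J"
    using I(1) unfolding J is_interval_connected_1
    by (intro connected_continuous_image continuous_intros)
  moreover have pq: "k * (p - t0) \<in> J" "k * (q - t0) \<in> J" "k * (p - t0) < k * (q - t0)"
    using I k by (auto simp: J)
  moreover have "continuous_on J \<gamma>"
  proof -
    have "continuous_on J \<iota>"
      unfolding \<iota>_def by (intro continuous_intros)
    moreover have "continuous_on I C"
      using C by (simp add: smooth_curve_def)
    ultimately have "continuous_on J (\<lambda>\<sigma>. C (\<iota> \<sigma>))"
      using \<iota>_J by (intro continuous_on_compose2[of I C J \<iota>]) simp_all
    then show ?thesis
      by (rule continuous_on_eq) (simp add: \<gamma>_\<iota>)
  qed
  moreover have "smooth_on {\<sigma> \<in> J. \<gamma> \<sigma> \<in> dom_chart c} (coords c \<circ> \<gamma>)" if c: "c \<in> A" for c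
    unfolding smooth_on_def
  proof
    fix n
    interpret chart_curve A I C c
      using A C c by unfold_locales
    let ?S = "{\<sigma> \<in> J. \<gamma> \<sigma> \<in> dom_chart c}"
    obtain U where U: "open U" "chart_times = I \<inter> U"
      using times_open .
    have S: "?S = J \<inter> \<iota> -` U"
      using U(2) \<iota>_J by (auto simp: \<gamma>_\<iota> chart_times_def)
    have "open (\<iota> -` U)"
      using U(1) k by (intro open_vimage) (auto simp: \<iota>_def intro!: continuous_intros)
    then have solid: "solid ?S"
      unfolding S by (rule solid_interval_Int_open[OF \<open>is_interval J\<close> pq])
    have "Ck_on n ?S (\<lambda>\<sigma>. (coords c \<circ> C) (\<iota> \<sigma>))"
    proof (rule Ck_on_compose[OF solid, where f = \<iota> and g = "coords c \<circ> C"])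
      show "Ck_on n ?S \<iota>"
        unfolding \<iota>_def
        by (intro Ck_on_add[OF solid] Ck_on_const[OF solid] Ck_on_linear_map[OF solid]
            bounded_linear_scaleR_right)
      show "Ck_on n chart_times (coords c \<circ> C)"
        using smooth_coords by (simp only: smooth_on_def)
      show "\<iota> ` ?S \<subseteq> chart_times"
        using \<iota>_J by (auto simp: \<gamma>_\<iota> chart_times_def)
    qed
    then show "Ck_on n ?S (coords c \<circ> \<gamma>)"
      by (rule Ck_on_cong[THEN iffD1, rotated]) (simp add: \<gamma>_\<iota>)
  qed
  ultimately have smooth: "smooth_curve A J \<gamma>"
    unfolding smooth_curve_def by blast
  then show "smooth_curve A J \<gamma>" .
  fix t :: real and c :: "'m chart"
  assume t: "t \<in> I" and c: "c \<in> A" and Ct: "C t \<in> dom_chart c"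
  let ?\<sigma> = "k * (t - t0)"
  interpret C: chart_curve A I C c
    using A C c by unfold_locales
  interpret \<gamma>: chart_curve A J \<gamma> c
    using A smooth c by unfold_locales
  have \<sigma>: "?\<sigma> \<in> \<gamma>.chart_times"
    using Ct imageI[OF t, of "\<lambda>t. k * (t - t0)"] by (simp add: \<gamma>.chart_times_def \<gamma>[OF t] flip: J)
  have "(\<iota> has_vector_derivative 1 / k) (at ?\<sigma> within J)"
    unfolding \<iota>_def by (auto intro!: derivative_eq_intros)
  moreover have "((coords c \<circ> C) has_vector_derivative velocity I C c t) (at (\<iota> ?\<sigma>) within \<iota> ` J)"
    unfolding inv \<iota>_J using t Ct by (intro C.has_velocity) (simp add: C.chart_times_def)
  ultimately have "((coords c \<circ> C) \<circ> \<iota> has_vector_derivative (1 / k) *\<^sub>R velocity I C c t)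
      (at ?\<sigma> within J)"
    by (rule vector_diff_chain_within)
  then have "((coords c \<circ> \<gamma>) has_vector_derivative (1 / k) *\<^sub>R velocity I C c t) (at ?\<sigma> within J)"
    by (rule \<gamma>.deriv_cong[OF \<sigma>, THEN iffD1, rotated]) (simp add: \<gamma>.chart_times_def \<gamma>_\<iota>)
  then show "velocity J \<gamma> c ?\<sigma> = (1 / k) *\<^sub>R velocity I C c t"
    unfolding velocity_def by (rule \<gamma>.vector_derivative_times[OF \<sigma>])
qed

section \<open>Null slant curves\<close>

locale null_slant_curve = sasaki_curve +
  fixes a :: real and \<Gamma>t
  assumes null: "t \<in> chart_times \<Longrightarrow> g c (C t) (V t) (V t) = 0"
    and nonzero: "t \<in> chart_times \<Longrightarrow> V t \<noteq> 0"
    and slant: "t \<in> chart_times \<Longrightarrow> \<eta> c (C t) (V t) = a"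
    and b_zero: "t \<in> chart_times \<Longrightarrow> g c (C t) (V t) (\<phi> c (C t) (V t)) = 0"
    and LCt: "levi_civita A (associated_metric \<phi> \<eta> g) \<Gamma>t"
begin

lemma a_nonzero:
  assumes "t \<in> chart_times"
  shows "a \<noteq> 0"
  using contact_B_space.null_eta_nonzero[OF tangent[OF assms] null[OF assms] nonzero[OF assms]
      b_zero[OF assms]] slant[OF assms] by simp

text \<open>The constants \<open>g(V, V)\<close>, \<open>\<eta>(V)\<close> and \<open>g(V, \<phi> V)\<close> are differentiated in turn. The third one
  contains the derivative of \<open>\<phi>\<close> and produces \<open>g(D, \<phi> V) = - a\<^sup>3\<close>. Hence \<open>D + a \<phi> V\<close> is
  orthogonal to \<open>V\<close>, \<open>\<phi> V\<close> and \<open>\<xi>\<close>.\<close>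

lemma acceleration:
  assumes t: "t \<in> chart_times"
  shows "(V has_vector_derivative
    (- a) *\<^sub>R \<phi> c (C t) (V t) - \<Gamma> c (C t) (V t) (V t)) (at t within I)"
proof -
  interpret T: contact_B_space "\<phi> c (C t)" "\<xi> c (C t)" "\<eta> c (C t)" "g c (C t)"
    using t by (rule tangent)
  let ?V = "V t" and ?p = "C t"
  define D where "D = vector_derivative V (at t within I) + \<Gamma> c ?p ?V ?V"
  have D: "(V has_vector_derivative D - \<Gamma> c ?p ?V ?V) (at t within I)"
    using smooth_has_vector_derivative[OF smooth_velocity t] by (simp add: D_def)
  have "g c ?p D ?V + g c ?p ?V D = 0"
    using metric_along[OF t D D] null by (rule deriv_const_along[OF t])
  then have D_V: "g c ?p D ?V = 0"
    using T.metric_sym[of D ?V] by simp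
  have "\<eta> c ?p D - g c ?p ?V (\<phi> c ?p ?V) = 0"
    using eta_along[OF t D] slant by (rule deriv_const_along[OF t])
  then have eta_D: "\<eta> c ?p D = 0"
    by (simp add: b_zero[OF t])
  have "g c ?p D (\<phi> c ?p ?V) + g c ?p ?V (\<phi> c ?p D - g c ?p ?V ?V *\<^sub>R \<xi> c ?p - \<eta> c ?p ?V *\<^sub>R ?V
      + (2 * \<eta> c ?p ?V * \<eta> c ?p ?V) *\<^sub>R \<xi> c ?p) = 0"
    using metric_along[OF t D phi_along[OF t D]] b_zero by (rule deriv_const_along[OF t])
  moreover have "g c ?p ?V (\<phi> c ?p D) = g c ?p D (\<phi> c ?p ?V)"
    by (simp add: T.metric_phi_swap T.metric_sym[of ?V])
  ultimately have D_phi: "g c ?p D (\<phi> c ?p ?V) = - (a * a * a)"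
    by (simp add: T.metric_simps T.metric_xi null[OF t] slant[OF t])
  have "D + a *\<^sub>R \<phi> c ?p ?V = 0"
  proof (rule T.null_nondeg[OF null[OF t] nonzero[OF t]])
    show "g c ?p (D + a *\<^sub>R \<phi> c ?p ?V) ?V = 0"
      by (simp add: T.metric_simps D_V T.metric_phi_swap b_zero[OF t])
    show "g c ?p (D + a *\<^sub>R \<phi> c ?p ?V) (\<phi> c ?p ?V) = 0"
      by (simp add: T.metric_simps D_phi T.metric_phi_phi null[OF t] slant[OF t])
    show "\<eta> c ?p (D + a *\<^sub>R \<phi> c ?p ?V) = 0"
      by (simp add: T.eta_simps eta_D T.eta_phi)
  qed
  then have "D = (- a) *\<^sub>R \<phi> c ?p ?V"
    by (simp add: eq_neg_iff_add_eq_0)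
  with D show ?thesis
    by simp
qed

lemma phi_velocity_along:
  assumes t: "t \<in> chart_times"
  shows "((\<lambda>t. \<phi> c (C t) (V t)) has_vector_derivative
    (a * a) *\<^sub>R \<xi> c (C t) - \<Gamma> c (C t) (V t) (\<phi> c (C t) (V t))) (at t within I)"
proof -
  interpret T: contact_B_space "\<phi> c (C t)" "\<xi> c (C t)" "\<eta> c (C t)" "g c (C t)"
    using t by (rule tangent)
  have "(2 * a * a) *\<^sub>R \<xi> c (C t) = (a * a) *\<^sub>R \<xi> c (C t) + (a * a) *\<^sub>R \<xi> c (C t)"
    by (simp flip: scaleR_add_left)
  then show ?thesis
    by (intro has_vector_derivative_eq_rhs[OF phi_along[OF t acceleration[OF t]]])
      (simp only: T.phi_simps T.phi_phi null[OF t] slant[OF t], simp add: algebra_simps)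
qed

lemma cov_deriv_along_associated:
  assumes t: "t \<in> chart_times"
    and F: "(F c has_vector_derivative D - \<Gamma> c (C t) (V t) (F c t)) (at t within I)"
  shows "cov_deriv_along \<Gamma>t I C F c t =
    D - (g c (C t) (V t) (\<phi> c (C t) (F c t)) - g c (C t) (\<phi> c (C t) (V t)) (\<phi> c (C t) (F c t))) *\<^sub>R \<xi> c (C t)"
proof -
  have "C t \<in> dom_chart c"
    using t by (simp add: chart_times_def)
  then show ?thesis
    by (simp add: cov_deriv_along_def vector_derivative_times[OF t F] associated_connection[OF LCt])
qed

end

section \<open>The Frenet frame of the unit speed curve\<close>

text \<open>Second and third vector of the frame of a curve \<open>\<gamma>\<close> for which \<open>\<eta>(\<gamma>')\<close> is the sign \<open>e\<close>. With
  \<open>\<gamma>' = C' / \<bar>a\<bar>\<close> and \<open>e = a / \<bar>a\<bar>\<close> they are \<open>- \<phi> C' / a + \<xi>\<close> and \<open>(\<phi> C' - C') / \<bar>a\<bar>\<close>.\<close>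

definition principal_normal ::
  "'m endo_field \<Rightarrow> 'm vec_field \<Rightarrow> real set \<Rightarrow> (real \<Rightarrow> 'm) \<Rightarrow> real \<Rightarrow> 'm field_along" where
  "principal_normal \<phi> \<xi> J \<gamma> e c t = - e *\<^sub>R \<phi> c (\<gamma> t) (velocity J \<gamma> c t) + \<xi> c (\<gamma> t)"

definition binormal :: "'m endo_field \<Rightarrow> real set \<Rightarrow> (real \<Rightarrow> 'm) \<Rightarrow> 'm field_along" where
  "binormal \<phi> J \<gamma> c t = \<phi> c (\<gamma> t) (velocity J \<gamma> c t) - velocity J \<gamma> c t"

context null_slant_curve
begin

abbreviation "E2 \<equiv> principal_normal \<phi> \<xi> I C a"
abbreviation "E3 \<equiv> binormal \<phi> I C"
abbreviation "h \<equiv> associated_metric \<phi> \<eta> g"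

lemma associated_orthonormal:
  assumes t: "t \<in> chart_times" and unit: "a * a = 1"
  shows "h c (C t) (V t) (V t) = 1" "h c (C t) (E2 c t) (E2 c t) = 1" "h c (C t) (E3 c t) (E3 c t) = - 1"
    "h c (C t) (V t) (E2 c t) = 0" "h c (C t) (V t) (E3 c t) = 0" "h c (C t) (E2 c t) (E3 c t) = 0"
    "h c (C t) (V t) (\<xi> c (C t)) = a"
proof -
  interpret T: contact_B_space "\<phi> c (C t)" "\<xi> c (C t)" "\<eta> c (C t)" "g c (C t)"
    using t by (rule tangent)
  have "g c (C t) (\<phi> c (C t) (V t)) (V t) = 0"
    by (simp add: T.metric_phi_swap b_zero[OF t])
  then show "h c (C t) (V t) (V t) = 1" "h c (C t) (E2 c t) (E2 c t) = 1"
    "h c (C t) (E3 c t) (E3 c t) = - 1"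
    "h c (C t) (V t) (E2 c t) = 0" "h c (C t) (V t) (E3 c t) = 0" "h c (C t) (E2 c t) (E3 c t) = 0"
    "h c (C t) (V t) (\<xi> c (C t)) = a"
    by (simp_all add: associated_metric_def principal_normal_def binormal_def T.phi_simps T.phi_phi T.phi_xi
        T.metric_simps T.metric_xi T.metric_phi_phi T.eta_simps T.eta_phi T.eta_xi null[OF t] slant[OF t] b_zero[OF t] unit)
qed

lemma has_derivative_frame:
  assumes t: "t \<in> chart_times" and unit: "a * a = 1"
  shows "(E2 c has_vector_derivative
      (- a) *\<^sub>R \<xi> c (C t) - \<phi> c (C t) (V t) - \<Gamma> c (C t) (V t) (E2 c t)) (at t within I)"
    and "(E3 c has_vector_derivative
      \<xi> c (C t) + a *\<^sub>R \<phi> c (C t) (V t) - \<Gamma> c (C t) (V t) (E3 c t)) (at t within I)"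
proof -
  have "C t \<in> dom_chart c"
    using t by (simp add: chart_times_def)
  note B = bilinear_conn[OF this]
  note \<Gamma>_simps = bilinear_radd[OF B] bilinear_rsub[OF B] bilinear_rmul[OF B] bilinear_rneg[OF B]
  note phi' = phi_velocity_along[OF t, unfolded unit scaleR_one]
  show "(E2 c has_vector_derivative
      (- a) *\<^sub>R \<xi> c (C t) - \<phi> c (C t) (V t) - \<Gamma> c (C t) (V t) (E2 c t)) (at t within I)"
    unfolding principal_normal_def[abs_def]
    by (rule has_vector_derivative_eq_rhs[OF has_vector_derivative_add[OF
          bounded_linear.has_vector_derivative[OF bounded_linear_scaleR_right phi'] xi_along[OF t]]])
      (simp add: \<Gamma>_simps algebra_simps)
  show "(E3 c has_vector_derivative
      \<xi> c (C t) + a *\<^sub>R \<phi> c (C t) (V t) - \<Gamma> c (C t) (V t) (E3 c t)) (at t within I)"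
    unfolding binormal_def[abs_def]
    by (rule has_vector_derivative_eq_rhs[OF has_vector_derivative_diff[OF phi' acceleration[OF t]]])
      (simp add: \<Gamma>_simps algebra_simps)
qed

text \<open>These are the Frenet equations with curvature and torsion 1, because \<open>- \<phi> V = - V - E3\<close>.\<close>

lemma frenet_equations:
  assumes t: "t \<in> chart_times" and unit: "a * a = 1"
  shows "cov_deriv_along \<Gamma>t I C (velocity I C) c t = E2 c t"
    and "cov_deriv_along \<Gamma>t I C E2 c t = - \<phi> c (C t) (V t)"
    and "cov_deriv_along \<Gamma>t I C E3 c t = - E2 c t"
proof -
  interpret T: contact_B_space "\<phi> c (C t)" "\<xi> c (C t)" "\<eta> c (C t)" "g c (C t)"
    using t by (rule tangent)
  have phi_V: "g c (C t) (\<phi> c (C t) (V t)) (V t) = 0"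
    by (simp add: T.metric_phi_swap b_zero[OF t])
  note facts = T.phi_simps T.phi_phi T.phi_xi T.metric_simps T.metric_xi T.metric_phi_phi T.eta_phi null[OF t] slant[OF t]
    b_zero[OF t] phi_V unit
  show "cov_deriv_along \<Gamma>t I C (velocity I C) c t = E2 c t"
    unfolding cov_deriv_along_associated[of _ "velocity I C", OF t acceleration[OF t]]
    by (simp add: facts principal_normal_def)
  show "cov_deriv_along \<Gamma>t I C E2 c t = - \<phi> c (C t) (V t)"
    unfolding cov_deriv_along_associated[of _ E2, OF t has_derivative_frame(1)[OF t unit]]
    by (simp add: facts principal_normal_def)
  show "cov_deriv_along \<Gamma>t I C E3 c t = - E2 c t"
    unfolding cov_deriv_along_associated[of _ E3, OF t has_derivative_frame(2)[OF t unit]]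
    by (simp add: facts principal_normal_def binormal_def, simp add: vec_eq_iff)
qed

lemma smooth_frame:
  shows "smooth_on chart_times (E2 c)" "smooth_on chart_times (E3 c)"
proof -
  have phi: "smooth_on chart_times (\<lambda>t. \<phi> c (C t) (V t))"
    using contact_B_space.linear_phi[OF tangent_space] smooth_phi smooth_velocity
    by (rule smooth_linear_along)
  have "Ck_on k chart_times (\<lambda>t. (- a) *\<^sub>R \<phi> c (C t) (V t) + \<xi> c (C t))" for k
    using phi smooth_along[OF smooth_xi] unfolding smooth_on_def
    by (intro Ck_on_add[OF solid_times] Ck_on_bounded_linear[OF solid_times bounded_linear_scaleR_right])
      blast+
  then show "smooth_on chart_times (E2 c)"
    by (simp add: smooth_on_def principal_normal_def[abs_def])
  have "Ck_on k chart_times (\<lambda>t. \<phi> c (C t) (V t) + (- 1) *\<^sub>R V t)" for k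
    using phi smooth_velocity unfolding smooth_on_def
    by (intro Ck_on_add[OF solid_times] Ck_on_bounded_linear[OF solid_times bounded_linear_scaleR_right])
      blast+
  then show "smooth_on chart_times (E3 c)"
    by (simp add: smooth_on_def binormal_def[abs_def])
qed

end

lemma frame_transition:
  assumes M: "sasaki_like A \<phi> \<xi> \<eta> g \<Gamma>" and J: "smooth_curve A J \<gamma>"
    and charts: "c \<in> A" "c' \<in> A" and t: "t \<in> J" "\<gamma> t \<in> dom_chart c" "\<gamma> t \<in> dom_chart c'"
  shows "velocity J \<gamma> c' t = jac c c' (\<gamma> t) (velocity J \<gamma> c t)"
    and "principal_normal \<phi> \<xi> J \<gamma> e c' t = jac c c' (\<gamma> t) (principal_normal \<phi> \<xi> J \<gamma> e c t)"
    and "binormal \<phi> J \<gamma> c' t = jac c c' (\<gamma> t) (binormal \<phi> J \<gamma> c t)"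
proof -
  interpret sasaki_curve A \<phi> \<xi> \<eta> g \<Gamma> c J \<gamma>
    using M J charts by unfold_locales
  have lin: "linear (jac c c' (\<gamma> t))"
    using jac_has_derivative[OF atlas charts t(2,3)] by (rule has_derivative_linear)
  note jac_simps = linear_add[OF lin] linear_diff[OF lin] linear_scale[OF lin] linear_neg[OF lin]
  show V: "velocity J \<gamma> c' t = jac c c' (\<gamma> t) (velocity J \<gamma> c t)"
    using t charts by (intro velocity_jac) (auto simp: chart_times_def)
  have "\<phi> c' (\<gamma> t) (jac c c' (\<gamma> t) v) = jac c c' (\<gamma> t) (\<phi> c (\<gamma> t) v)" for v
    using almost_contact charts t
    unfolding almost_contact_B_metric_def endomorphism_field_def by blast
  moreover have "\<xi> c' (\<gamma> t) = jac c c' (\<gamma> t) (\<xi> c (\<gamma> t))"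
    using almost_contact charts t unfolding almost_contact_B_metric_def vector_field_def by blast
  ultimately show "principal_normal \<phi> \<xi> J \<gamma> e c' t = jac c c' (\<gamma> t) (principal_normal \<phi> \<xi> J \<gamma> e c t)"
    and "binormal \<phi> J \<gamma> c' t = jac c c' (\<gamma> t) (binormal \<phi> J \<gamma> c t)"
    by (simp_all add: principal_normal_def binormal_def V jac_simps)
qed

lemma null_slant_curve_in_chart:
  assumes "sasaki_like A \<phi> \<xi> \<eta> g \<Gamma>" "levi_civita A (associated_metric \<phi> \<eta> g) \<Gamma>t"
    and "null_curve A g I C" "slant A \<eta> I C a"
    and "\<forall>t\<in>I. \<forall>c\<in>A. C t \<in> dom_chart c \<longrightarrow>
      g c (C t) (velocity I C c t) (\<phi> c (C t) (velocity I C c t)) = 0"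
    and "c \<in> A"
  shows "null_slant_curve A \<phi> \<xi> \<eta> g \<Gamma> c I C a \<Gamma>t"
proof -
  interpret sasaki_curve A \<phi> \<xi> \<eta> g \<Gamma> c I C
    using assms by unfold_locales (auto simp: null_curve_def)
  show ?thesis
    using assms by unfold_locales (auto simp: null_curve_def slant_def chart_times_def)
qed

lemma associated_frenet_frame:
  assumes M: "sasaki_like A \<phi> \<xi> \<eta> g \<Gamma>" and LCt: "levi_civita A (associated_metric \<phi> \<eta> g) \<Gamma>t"
    and null: "null_curve A g J \<gamma>" and slant: "slant A \<eta> J \<gamma> e"
    and b: "\<forall>t\<in>J. \<forall>c\<in>A. \<gamma> t \<in> dom_chart c \<longrightarrow>
      g c (\<gamma> t) (velocity J \<gamma> c t) (\<phi> c (\<gamma> t) (velocity J \<gamma> c t)) = 0"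
    and unit: "e * e = 1"
  shows "frenet_frame A (associated_metric \<phi> \<eta> g) \<Gamma>t J \<gamma> 1 1 (- 1)
      (velocity J \<gamma>) (principal_normal \<phi> \<xi> J \<gamma> e) (binormal \<phi> J \<gamma>) (\<lambda>_. 1) (\<lambda>_. 1)"
    and "slant_wrt_metric A (associated_metric \<phi> \<eta> g) \<xi> J \<gamma> e"
proof -
  have smooth: "smooth_curve A J \<gamma>"
    using null by (simp add: null_curve_def)
  note in_chart = null_slant_curve_in_chart[OF M LCt null slant b]
  let ?h = "associated_metric \<phi> \<eta> g" and ?V = "velocity J \<gamma>"
    and ?E2 = "principal_normal \<phi> \<xi> J \<gamma> e" and ?E3 = "binormal \<phi> J \<gamma>"
  have frame: "?h c (\<gamma> s) (?V c s) (?V c s) = 1" "?h c (\<gamma> s) (?E2 c s) (?E2 c s) = 1"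
    "?h c (\<gamma> s) (?E3 c s) (?E3 c s) = - 1" "?h c (\<gamma> s) (?V c s) (?E2 c s) = 0"
    "?h c (\<gamma> s) (?V c s) (?E3 c s) = 0" "?h c (\<gamma> s) (?E2 c s) (?E3 c s) = 0"
    "?h c (\<gamma> s) (?V c s) (\<xi> c (\<gamma> s)) = e"
    "cov_deriv_along \<Gamma>t J \<gamma> ?V c s = ?E2 c s"
    "cov_deriv_along \<Gamma>t J \<gamma> ?E2 c s = - ?V c s - ?E3 c s"
    "cov_deriv_along \<Gamma>t J \<gamma> ?E3 c s = - ?E2 c s"
    if "c \<in> A" "s \<in> J" "\<gamma> s \<in> dom_chart c" for c s
  proof -
    interpret null_slant_curve A \<phi> \<xi> \<eta> g \<Gamma> c J \<gamma> e \<Gamma>t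
      by (rule in_chart[OF that(1)])
    have s: "s \<in> chart_times"
      using that by (simp add: chart_times_def)
    show "?h c (\<gamma> s) (?V c s) (?V c s) = 1" "?h c (\<gamma> s) (?E2 c s) (?E2 c s) = 1"
      "?h c (\<gamma> s) (?E3 c s) (?E3 c s) = - 1" "?h c (\<gamma> s) (?V c s) (?E2 c s) = 0"
      "?h c (\<gamma> s) (?V c s) (?E3 c s) = 0" "?h c (\<gamma> s) (?E2 c s) (?E3 c s) = 0"
      "?h c (\<gamma> s) (?V c s) (\<xi> c (\<gamma> s)) = e"
      by (fact associated_orthonormal[OF s unit])+
    show "cov_deriv_along \<Gamma>t J \<gamma> ?V c s = ?E2 c s"
      "cov_deriv_along \<Gamma>t J \<gamma> ?E2 c s = - ?V c s - ?E3 c s"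
      "cov_deriv_along \<Gamma>t J \<gamma> ?E3 c s = - ?E2 c s"
      by (simp_all add: frenet_equations[OF s unit] binormal_def)
  qed
  have fields: "smooth_field_along A J \<gamma> (velocity J \<gamma>)"
    "smooth_field_along A J \<gamma> (principal_normal \<phi> \<xi> J \<gamma> e)" "smooth_field_along A J \<gamma> (binormal \<phi> J \<gamma>)"
  proof -
    have "smooth_on {t \<in> J. \<gamma> t \<in> dom_chart c} (velocity J \<gamma> c)"
      "smooth_on {t \<in> J. \<gamma> t \<in> dom_chart c} (principal_normal \<phi> \<xi> J \<gamma> e c)"
      "smooth_on {t \<in> J. \<gamma> t \<in> dom_chart c} (binormal \<phi> J \<gamma> c)" if "c \<in> A" for c
    proof -
      interpret null_slant_curve A \<phi> \<xi> \<eta> g \<Gamma> c J \<gamma> e \<Gamma>t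
        by (rule in_chart[OF that])
      show "smooth_on {t \<in> J. \<gamma> t \<in> dom_chart c} (velocity J \<gamma> c)"
        "smooth_on {t \<in> J. \<gamma> t \<in> dom_chart c} (principal_normal \<phi> \<xi> J \<gamma> e c)"
        "smooth_on {t \<in> J. \<gamma> t \<in> dom_chart c} (binormal \<phi> J \<gamma> c)"
        using smooth_velocity smooth_frame by (simp_all add: chart_times_def)
    qed
    then show "smooth_field_along A J \<gamma> (velocity J \<gamma>)"
      "smooth_field_along A J \<gamma> (principal_normal \<phi> \<xi> J \<gamma> e)" "smooth_field_along A J \<gamma> (binormal \<phi> J \<gamma>)"
      using frame_transition[OF M smooth] unfolding smooth_field_along_def by blast+
  qed
  have "unit_speed_curve A ?h J \<gamma> 1"
    using smooth frame(1) by (simp add: unit_speed_curve_def)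
  then show "frenet_frame A ?h \<Gamma>t J \<gamma> 1 1 (- 1) ?V ?E2 ?E3 (\<lambda>_. 1) (\<lambda>_. 1)"
    using fields by (simp add: frenet_frame_def frame)
  show "slant_wrt_metric A ?h \<xi> J \<gamma> e"
    by (simp add: slant_wrt_metric_def frame)
qed

text \<open>For any Frenet frame of the curve, the first equation forces its second vector to be a constant
  multiple of \<open>E2\<close>. With vanishing torsion the second equation would then make \<open>\<phi> V\<close> a multiple of
  the null vector \<open>V\<close>, contradicting \<open>g(\<phi> V, \<phi> V) = e\<^sup>2 = 1\<close>.\<close>

lemma associated_not_pseudo_circle:
  assumes M: "sasaki_like A \<phi> \<xi> \<eta> g \<Gamma>" and LCt: "levi_civita A (associated_metric \<phi> \<eta> g) \<Gamma>t"
    and null: "null_curve A g J \<gamma>" and slant: "slant A \<eta> J \<gamma> e"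
    and b: "\<forall>t\<in>J. \<forall>c\<in>A. \<gamma> t \<in> dom_chart c \<longrightarrow>
      g c (\<gamma> t) (velocity J \<gamma> c t) (\<phi> c (\<gamma> t) (velocity J \<gamma> c t)) = 0"
    and unit: "e * e = 1"
  shows "\<not> pseudo_circle A (associated_metric \<phi> \<eta> g) \<Gamma>t J \<gamma>"
proof
  assume "pseudo_circle A (associated_metric \<phi> \<eta> g) \<Gamma>t J \<gamma>"
  then obtain \<epsilon>1 \<epsilon>2 \<epsilon>3 F1 F2 F3 k where k: "k > 0" and
    F: "frenet_frame A (associated_metric \<phi> \<eta> g) \<Gamma>t J \<gamma> \<epsilon>1 \<epsilon>2 \<epsilon>3 F1 F2 F3 (\<lambda>_. k) (\<lambda>_. 0)"
    by (auto simp: pseudo_circle_def)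
  obtain s where s: "s \<in> J"
    using null by (auto simp: null_curve_def smooth_curve_def)
  have "smooth_atlas A"
    using M by (simp add: sasaki_like_def almost_contact_B_metric_def)
  then obtain c where chart_s: "c \<in> A" "\<gamma> s \<in> dom_chart c"
    unfolding smooth_atlas_def by blast
  interpret null_slant_curve A \<phi> \<xi> \<eta> g \<Gamma> c J \<gamma> e \<Gamma>t
    by (rule null_slant_curve_in_chart[OF M LCt null slant b chart_s(1)])
  have s_times: "s \<in> chart_times"
    using s chart_s by (simp add: chart_times_def)
  define m where "m = \<epsilon>2 * k"
  have m: "m \<noteq> 0"
    using F k by (auto simp: frenet_frame_def m_def)
  have F1: "F1 c r = V r" and D_F1: "cov_deriv_along \<Gamma>t J \<gamma> F1 c r = m *\<^sub>R F2 c r"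
    and D_F2: "cov_deriv_along \<Gamma>t J \<gamma> F2 c r = (- \<epsilon>1 * k) *\<^sub>R F1 c r"
    if "r \<in> chart_times" for r
    using F that c unfolding frenet_frame_def chart_times_def m_def by auto
  have "cov_deriv_along \<Gamma>t J \<gamma> F1 c r = E2 c r" if r: "r \<in> chart_times" for r
    using frenet_equations(1)[OF r unit] vector_derivative_cong_times[OF r, of "F1 c" V] F1[OF r] F1
    by (simp add: cov_deriv_along_def)
  then have F2: "F2 c r = (1 / m) *\<^sub>R E2 c r" if "r \<in> chart_times" for r
    using D_F1[OF that] m that by simp
  have "((\<lambda>r. (1 / m) *\<^sub>R E2 c r) has_vector_derivative
      (1 / m) *\<^sub>R vector_derivative (E2 c) (at s within J)) (at s within J)"
    using smooth_has_vector_derivative[OF smooth_frame(1) s_times]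
    by (rule bounded_linear.has_vector_derivative[OF bounded_linear_scaleR_right])
  then have "vector_derivative (F2 c) (at s within J) = (1 / m) *\<^sub>R vector_derivative (E2 c) (at s within J)"
    using vector_derivative_times[OF s_times] vector_derivative_cong_times[OF s_times F2] by simp
  moreover have "bilinear (\<Gamma>t c (\<gamma> s))"
    using LCt chart_s by (auto simp: levi_civita_def affine_connection_def)
  ultimately have "cov_deriv_along \<Gamma>t J \<gamma> F2 c s = (1 / m) *\<^sub>R cov_deriv_along \<Gamma>t J \<gamma> E2 c s"
    by (simp add: cov_deriv_along_def F2[OF s_times] bilinear_rmul scaleR_add_right)
  then have "(1 / m) *\<^sub>R \<phi> c (\<gamma> s) (V s) = (\<epsilon>1 * k) *\<^sub>R V s"
    by (simp add: frenet_equations(2)[OF s_times unit] D_F2[OF s_times] F1[OF s_times])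
  then have "m *\<^sub>R (1 / m) *\<^sub>R \<phi> c (\<gamma> s) (V s) = m *\<^sub>R (\<epsilon>1 * k) *\<^sub>R V s"
    by simp
  then have parallel: "\<phi> c (\<gamma> s) (V s) = m *\<^sub>R (\<epsilon>1 * k) *\<^sub>R V s"
    using m by simp
  interpret T: contact_B_space "\<phi> c (\<gamma> s)" "\<xi> c (\<gamma> s)" "\<eta> c (\<gamma> s)" "g c (\<gamma> s)"
    by (rule tangent[OF s_times])
  have "g c (\<gamma> s) (\<phi> c (\<gamma> s) (V s)) (\<phi> c (\<gamma> s) (V s)) = 0"
    unfolding parallel by (simp add: T.metric_simps null[OF s_times])
  then show False
    by (simp add: T.metric_phi_phi null[OF s_times] slant[OF s_times] unit)
qed

section \<open>Arc length\<close>

lemma arc_length_affine: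
  assumes I: "is_interval I" and speed: "\<And>t. t \<in> I \<Longrightarrow> speed A h I C t = v"
    and s: "arc_length_parameter A h I C s"
  obtains t0 where "\<And>t. t \<in> I \<Longrightarrow> s t = v * (t - t0)"
proof -
  obtain t0 where t0: "t0 \<in> I"
    "\<And>t. t \<in> I \<Longrightarrow> s t = integral {t0..t} (speed A h I C) - integral {t..t0} (speed A h I C)"
    using s by (auto simp: arc_length_parameter_def)
  have int: "integral {x..y} (speed A h I C) = v * max 0 (y - x)" if "x \<in> I" "y \<in> I" for x y
  proof -
    have "integral {x..y} (speed A h I C) = integral {x..y} (\<lambda>_. v)"
      using mem_is_interval_1_I[OF I that] by (intro integral_cong speed) auto
    then show ?thesis
      by (simp add: max_def)
  qed
  have "s t = v * (t - t0)" if "t \<in> I" for t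
    using t0(2)[OF that] int[OF t0(1) that] int[OF that t0(1)]
    by (cases "t0 \<le> t") (simp_all add: algebra_simps)
  then show thesis
    by (rule that)
qed

theorem theorem5p2:
  fixes A :: "'m::{t2_space,second_countable_topology} chart set"
    and \<phi> :: "'m endo_field" and \<xi> :: "'m vec_field" and \<eta> :: "'m form_field"
    and g gt :: "'m bilin_field" and \<Gamma> \<Gamma>t :: "'m conn"
    and I J :: "real set" and C \<gamma> :: "real \<Rightarrow> 'm" and N W :: "'m field_along"
    and a :: real and s :: "real \<Rightarrow> real"
  assumes M: "sasaki_like A \<phi> \<xi> \<eta> g \<Gamma>"
    and gt: "gt = associated_metric \<phi> \<eta> g"
    and \<Gamma>t: "levi_civita A gt \<Gamma>t"
    and null: "null_curve A g I C"
    and slant: "slant A \<eta> I C a"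
    and b: "\<forall>t\<in>I. \<forall>c\<in>A. C t \<in> dom_chart c \<longrightarrow>
              g c (C t) (velocity I C c t) (\<phi> c (C t) (velocity I C c t)) = 0"
    and frame: "null_frenet_frame A g \<Gamma> I C N W"
    and s: "arc_length_parameter A gt I C s"
    and J: "J = s ` I"
    and \<gamma>: "\<gamma> = C \<circ> inv_into I s"
  shows "strict_mono_on I s \<and>
    spacelike_curve A gt J \<gamma> \<and>
    (\<exists>a'. slant_wrt_metric A gt \<xi> J \<gamma> a' \<and> slant A \<eta> J \<gamma> a') \<and>
    frenet_curve3 A gt \<Gamma>t J \<gamma> \<and>
    (\<exists>E1 E2 E3 k \<tau>.
       frenet_apparatus3 A gt \<Gamma>t J \<gamma> 1 1 (-1) E1 E2 E3 k \<tau> \<and>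
       (\<forall>t\<in>I. \<forall>c\<in>A. C t \<in> dom_chart c \<longrightarrow>
          E1 c (s t) = velocity J \<gamma> c (s t) \<and>
          E1 c (s t) = (1 / \<bar>a\<bar>) *\<^sub>R velocity I C c t \<and>
          E2 c (s t) = - (1 / a) *\<^sub>R \<phi> c (C t) (velocity I C c t) + \<xi> c (C t) \<and>
          E3 c (s t) = (1 / \<bar>a\<bar>) *\<^sub>R (\<phi> c (C t) (velocity I C c t) - velocity I C c t)) \<and>
       (\<forall>\<sigma>\<in>J. k \<sigma> = 1 \<and> \<tau> \<sigma> = 1)) \<and>
    proper_helix A gt \<Gamma>t J \<gamma>"
proof -
  have A: "smooth_atlas A"
    using M by (simp add: sasaki_like_def almost_contact_B_metric_def)
  have smooth: "smooth_curve A I C"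
    using null by (simp add: null_curve_def)
  have chart: "\<exists>c. c \<in> A \<and> p \<in> dom_chart c" for p
    using A unfolding smooth_atlas_def by blast
  have in_chart: "null_slant_curve A \<phi> \<xi> \<eta> g \<Gamma> c I C a \<Gamma>t" if "c \<in> A" for c
    using null_slant_curve_in_chart[OF M \<Gamma>t[unfolded gt] null slant b that] .
  have tangent: "contact_B_space (\<phi> c p) (\<xi> c p) (\<eta> c p) (g c p)" if "c \<in> A" "p \<in> dom_chart c" for c p
    using that M by (intro sasaki_chart.tangent_space) (simp add: sasaki_chart_def)
  obtain t1 where "t1 \<in> I"
    using smooth by (auto simp: smooth_curve_def)
  obtain c1 where "c1 \<in> A" "C t1 \<in> dom_chart c1"
    using chart by blast
  have a: "a \<noteq> 0"
  proof -
    interpret null_slant_curve A \<phi> \<xi> \<eta> g \<Gamma> c1 I C a \<Gamma>t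
      by (rule in_chart[OF \<open>c1 \<in> A\<close>])
    show ?thesis
      using a_nonzero \<open>t1 \<in> I\<close> \<open>C t1 \<in> dom_chart c1\<close> by (simp add: chart_times_def)
  qed
  have "speed A gt I C t = \<bar>a\<bar>" if "t \<in> I" for t
  proof -
    define c where "c = (SOME c. c \<in> A \<and> C t \<in> dom_chart c)"
    have c: "c \<in> A" "C t \<in> dom_chart c"
      using someI_ex[OF chart] unfolding c_def by blast+
    have "gt c (C t) (velocity I C c t) (velocity I C c t) = a * a"
      using b slant that c by (simp add: gt associated_metric_def slant_def)
    then show ?thesis
      by (simp add: speed_def c_def Let_def flip: c_def)
  qed
  then obtain t0 where s_eq: "\<And>t. t \<in> I \<Longrightarrow> s t = \<bar>a\<bar> * (t - t0)"
    using arc_length_affine[OF _ _ s] smooth unfolding smooth_curve_def by metis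
  have mono: "strict_mono_on I s"
    using a by (auto simp: strict_mono_on_def s_eq)
  have \<gamma>_s: "\<gamma> (s t) = C t" if "t \<in> I" for t
    using inv_into_f_f[OF strict_mono_on_imp_inj_on[OF mono] that] by (simp add: \<gamma>)
  have \<gamma>_eq: "\<gamma> (\<bar>a\<bar> * (t - t0)) = C t" if "t \<in> I" for t
    using s_eq \<gamma>_s that by simp
  have "\<bar>a\<bar> > 0" "J = (\<lambda>t. \<bar>a\<bar> * (t - t0)) ` I"
    using a s_eq unfolding J by auto
  note reparam = affine_reparametrization[OF A smooth this]
  have smooth': "smooth_curve A J \<gamma>"
    by (rule reparam(1)) (rule \<gamma>_eq)
  have velocity: "velocity J \<gamma> c (s t) = (1 / \<bar>a\<bar>) *\<^sub>R velocity I C c t"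
    if "t \<in> I" "c \<in> A" "C t \<in> dom_chart c" for t c
    unfolding s_eq[OF that(1)] by (rule reparam(2)[OF _ that]) (rule \<gamma>_eq)
  define e where "e = a / \<bar>a\<bar>"
  have unit: "e * e = 1"
    using a by (simp add: e_def)
  have unit_facts: "g c (\<gamma> \<sigma>) (velocity J \<gamma> c \<sigma>) (velocity J \<gamma> c \<sigma>) = 0 \<and> velocity J \<gamma> c \<sigma> \<noteq> 0 \<and>
      \<eta> c (\<gamma> \<sigma>) (velocity J \<gamma> c \<sigma>) = e \<and>
      g c (\<gamma> \<sigma>) (velocity J \<gamma> c \<sigma>) (\<phi> c (\<gamma> \<sigma>) (velocity J \<gamma> c \<sigma>)) = 0"
    if "\<sigma> \<in> J" "c \<in> A" "\<gamma> \<sigma> \<in> dom_chart c" for \<sigma> c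
  proof -
    obtain t where t: "t \<in> I" "\<sigma> = s t"
      using \<open>\<sigma> \<in> J\<close> by (auto simp: J)
    with that have Ct: "C t \<in> dom_chart c"
      by (simp add: \<gamma>_s)
    interpret T: contact_B_space "\<phi> c (C t)" "\<xi> c (C t)" "\<eta> c (C t)" "g c (C t)"
      by (rule tangent[OF \<open>c \<in> A\<close> Ct])
    show ?thesis
      using null slant b t Ct that(2) a
      by (simp add: null_curve_def slant_def \<gamma>_s velocity T.metric_simps T.phi_simps T.eta_simps e_def)
  qed
  have null': "null_curve A g J \<gamma>" and slant': "slant A \<eta> J \<gamma> e"
    and b': "\<forall>t\<in>J. \<forall>c\<in>A. \<gamma> t \<in> dom_chart c \<longrightarrow>
      g c (\<gamma> t) (velocity J \<gamma> c t) (\<phi> c (\<gamma> t) (velocity J \<gamma> c t)) = 0"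
    using unit_facts smooth' by (simp_all add: null_curve_def slant_def)
  note unit_curve = M \<Gamma>t[unfolded gt] null' slant' b' unit
  let ?E2 = "principal_normal \<phi> \<xi> J \<gamma> e" and ?E3 = "binormal \<phi> J \<gamma>"
  note fr = associated_frenet_frame(1)[OF unit_curve, folded gt]
  have app: "frenet_apparatus3 A gt \<Gamma>t J \<gamma> 1 1 (-1) (velocity J \<gamma>) ?E2 ?E3 (\<lambda>_. 1) (\<lambda>_. 1)"
    using fr by (simp add: frenet_apparatus3_def)
  have fields: "\<forall>t\<in>I. \<forall>c\<in>A. C t \<in> dom_chart c \<longrightarrow>
      velocity J \<gamma> c (s t) = velocity J \<gamma> c (s t) \<and>
      velocity J \<gamma> c (s t) = (1 / \<bar>a\<bar>) *\<^sub>R velocity I C c t \<and>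
      ?E2 c (s t) = - (1 / a) *\<^sub>R \<phi> c (C t) (velocity I C c t) + \<xi> c (C t) \<and>
      ?E3 c (s t) = (1 / \<bar>a\<bar>) *\<^sub>R (\<phi> c (C t) (velocity I C c t) - velocity I C c t)"
  proof (intro ballI impI)
    fix t c
    assume t: "t \<in> I" "c \<in> A" "C t \<in> dom_chart c"
    interpret T: contact_B_space "\<phi> c (C t)" "\<xi> c (C t)" "\<eta> c (C t)" "g c (C t)"
      by (rule tangent[OF t(2,3)])
    have "e * (1 / \<bar>a\<bar>) = 1 / a"
      using a by (simp add: e_def field_simps abs_if)
    then show "velocity J \<gamma> c (s t) = velocity J \<gamma> c (s t) \<and>
      velocity J \<gamma> c (s t) = (1 / \<bar>a\<bar>) *\<^sub>R velocity I C c t \<and>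
      ?E2 c (s t) = - (1 / a) *\<^sub>R \<phi> c (C t) (velocity I C c t) + \<xi> c (C t) \<and>
      ?E3 c (s t) = (1 / \<bar>a\<bar>) *\<^sub>R (\<phi> c (C t) (velocity I C c t) - velocity I C c t)"
      using t by (simp add: principal_normal_def binormal_def velocity \<gamma>_s T.phi_simps scaleR_diff_right)
  qed
  have "helix A gt \<Gamma>t J \<gamma>"
    unfolding helix_def using fr zero_less_one zero_le_one by blast
  moreover have "\<not> pseudo_circle A gt \<Gamma>t J \<gamma>"
    using associated_not_pseudo_circle[OF unit_curve] by (simp add: gt)
  ultimately have "proper_helix A gt \<Gamma>t J \<gamma>"
    by (simp add: proper_helix_def)
  moreover have "spacelike_curve A gt J \<gamma>"
    using fr by (simp add: frenet_frame_def)
  moreover have "slant_wrt_metric A gt \<xi> J \<gamma> e"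
    using associated_frenet_frame(2)[OF unit_curve] by (simp add: gt)
  moreover have "frenet_curve3 A gt \<Gamma>t J \<gamma>"
    using app unfolding frenet_curve3_def by blast
  moreover have "\<forall>\<sigma>\<in>J. (\<lambda>_. 1 :: real) \<sigma> = 1 \<and> (\<lambda>_. 1 :: real) \<sigma> = 1"
    by simp
  ultimately show ?thesis
    using mono slant' app fields by blast
qed

end
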